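(* Let $H\in\mathcal{B}(\mathcal{H}_C)$ be Hermitian, let $(L_j)_{j=1}^{N_L}$, $(J_j)_{j=1}^{N_L}$ be finite sequences of operators in $\mathcal{B}(\mathcal{H}_C)$, and consider a ticking clock with classical register written in the form $\mathcal{M}^t_{CR\to CR}=e^{t\mathcal{L}_{CR}}$, where $$\mathcal{L}_{CR}(\cdot)=-i[\tilde H,(\cdot)]+\sum_{j=1}^{N_L}\Big(\tilde L_j(\cdot)\tilde L_j^\dagger-\tfrac12\{\tilde L_j^\dagger\tilde L_j,(\cdot)\}\Big)+\sum_{j=1}^{N_L}\Big(\tilde J_j^{(l)}(\cdot)\tilde J_j^{(l)\dagger}-\tfrac12\{\tilde J_j^{(l)\dagger}\tilde J_j^{(l)},(\cdot)\}\Big),$$ with $\tilde H=H\otimes\mathbb{1}_R$, $\tilde L_j=L_j\otimes\mathbb{1}_R$, $\tilde J^{(l)}_j=J_j\otimes O^{(l)}_R$, $O_R^{(l)}=\sum_{n=0}^{N_T-1}|n+1\rangle\langle n|_R+l\,|0\rangle\langle N_T|_R$, and $l=1$ for a periodic register, $l=0$ for a cut-off register. Put $$\mathcal{L}_C(\cdot)=-i[H,(\cdot)]+\sum_{j=1}^{N_L}\Big(L_j(\cdot)L_j^\dagger-\tfrac12\{L_j^\dagger L_j,(\cdot)\}\Big)+\sum_{j=1}^{N_L}\Big(J_j(\cdot)J_j^\dagger-\tfrac12\{J_j^\dagger J_j,(\cdot)\}\Big).$$ (i) In the periodic register case, the clockwork channel $$\mathcal{M}^t_{C\to C}(\cdot):=\mathrm{tr}_R\big[\mathcal{M}^t_{CR\to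 CR}((\cdot)\otimes|k\rangle\langle k|_R)\big]$$ is independent of $k$ for all $t\ge0$ and of the form $\mathcal{M}^t_{C\to C}(\cdot)=e^{t\mathcal{L}_C}(\cdot)$. (ii) In the cut-off register case, there exists a ticking clock which is clockwork equivalent to the given one and whose clockwork channel (defined by the same formula from its own channel) is independent of $k$ and given by $e^{t\mathcal{L}_C}(\cdot)$.
   Context: Notation. $\mathcal{H}_C$ is a finite-dimensional complex Hilbert space (the clockwork). $\mathcal{H}_R$ is the complex Hilbert space with orthonormal basis $|0\rangle_R,\dots,|N_T\rangle_R$ (the tick register), $N_T\in\mathbb{N}_{>0}$. $\mathcal{B}(\mathcal{H})$ denotes the (bounded) linear operators and $\mathcal{S}(\mathcal{H})$ the density operators on $\mathcal{H}$. A channel is a completely positive trace-preserving linear map. $\{A,B\}=AB+BA$. $\mathrm{tr}_C,\mathrm{tr}_R$ are partial traces; tensor products with identities are omitted when clear. $(\mathcal{M}^t_{CR\to CR})_{t\ge0}$ is a family of channels on $\mathcal{B}(\mathcal{H}_C\otimes\mathcal{H}_R)$, and for $k=0,\dots,N_T$ $$\mathcal{M}^{t,k}_{C\to CR}(\cdot):=\mathcal{M}^t_{CR\to CR}\big((\cdot)\otimes|k\rangle\langle k|_R\big).$$ $o(\cdot)$ is little-o notation. There are two kinds of register, periodic and cut-off. The periodic register satisfies $|n\rangle_R=|n\bmod (N_T+1)\rangle_R$ for $n\in\mathbb{Z}$. Conditions. 1) (Time invariance) $\mathrm{tr}_R[\mathcal{M}^{t,k}_{C\to CR}(\rho_C)\,|k+l\rangle\langle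 k+l|_R]=\mathrm{tr}_R[\mathcal{M}^{t,k'}_{C\to CR}(\rho_C)\,|k'+l\rangle\langle k'+l|_R]$ for all $t\ge0$, $\rho_C\in\mathcal{S}(\mathcal{H}_C)$, and all $l\in\mathbb{Z}$, $k,k'\in\{0,1,\dots,N_T\}$ such that $k+l,\,k'+l\in\{0,1,\dots,N_T\}$. 2) (Self-timing) $\mathcal{M}^{t_1+t_2}_{CR\to CR}=\mathcal{M}^{t_2}_{CR\to CR}\circ\mathcal{M}^{t_1}_{CR\to CR}$ for all $t_1,t_2\ge0$. 3) (Zeroth order) $\mathcal{M}^0_{CR\to CR}$ is the identity channel $\mathcal{I}_{CR}$ and $\lim_{t\to0^+}\|\mathcal{M}^t_{CR\to CR}-\mathcal{I}_{CR}\|=0$. 4) (Leading order) With $\tilde p^{(k)}_l(t):=\mathrm{tr}[\mathcal{M}^{t,k}_{C\to CR}(\rho_C)\,|l\rangle\langle l|_R]$ and $f(k)=k+1\bmod (N_T+1)$, $$\lim_{t\to0^+}\frac{\sum_{0\le l\le N_T,\ l\notin\{k,f(k)\}}\tilde p^{(k)}_l(t)}{\tilde p^{(k)}_{f(k)}(t)}=0$$ for all $k\in\{0,\dots,N_T\}$ and $\rho_C\in\mathcal{S}(\mathcal{H}_C)$. 5) (Cut-off register) There exists a ticking clock channel with a periodic register, denoted $\tilde{\mathcal{M}}^t_{CR\to CR}$ and satisfying 1)–4), such that in the limit $t\to0^+$, for all $\rho_C\in\mathcal{S}(\mathcal{H}_C)$: (5a) $\mathcal{M}^{t,k}_{C\to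 CR}(\rho_C)=\tilde{\mathcal{M}}^{t,k}_{C\to CR}(\rho_C)+o(t)$ for $k=0,\dots,N_T-1$; and (5b) $\mathrm{tr}_C[\mathcal{M}^{t,N_T}_{C\to CR}(\rho_C)]=|N_T\rangle\langle N_T|_R+o(t)$. Ticking clock: a pair $(\rho^0_{CR},(\mathcal{M}^t_{CR\to CR})_{t\ge0})$ with $\rho^0_{CR}\in\mathcal{S}(\mathcal{H}_C\otimes\mathcal{H}_R)$ (the state of clockwork and register at time $t=0$) such that the channels satisfy 1)–4) in the case of a periodic register, and 2) and 5) in the case of a cut-off register. Classical register: for all $t\ge0$, $k=0,\dots,N_T$ and $\rho_C\in\mathcal{S}(\mathcal{H}_C)$, $\mathcal{M}^{t,k}_{C\to CR}(\rho_C)=\sum_{n=0}^{N_T}\rho_C^{(n;k)}(t)\otimes|n\rangle\langle n|_R$, where the $\rho_C^{(n;k)}(t)$ are arbitrary subnormalised states on $\mathcal{H}_C$. Clockwork equivalence: two ticking clocks with a cut-off register are said to be clockwork equivalent if the two following conditions are both satisfied: (a) their underlying ticking clock channels with a periodic register in (5a), namely $\tilde{\mathcal{M}}^t_{CR\to CR}$, are the same in both cases; (b) the states of their clockwork when inputting the register state $|N_T\rangle\langle N_T|_R$, namely $\mathrm{tr}_R[\mathcal{M}^{t,N_T}_{C\to CR}(\rho_C)]$, differ for some $t\ge0$ and $\rho_C\in\mathcal{S}(\mathcal{H}_C)$.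
   Formalization: In (ii) the new clock is equal or clockwork equivalent to the given one: if the given clock already has clockwork channel e^{tL_C} (e.g. dim H_C = 1, J_1 = 1), condition (b) of clockwork equivalence cannot hold, so the literal claim fails; in all other cases (ii) holds as written. *)

theory Defs
  imports "HOL-Analysis.Analysis" "HOL-Library.Landau_Symbols"
begin

section \<open>Operators on finite-dimensional complex Hilbert spaces\<close>

text \<open>A Hilbert space of dimension \<open>CARD('m)\<close> is \<open>complex^'m\<close> with its standard inner product, and
  its operators are square matrices.\<close>

type_synonym 'm op = "complex^'m^'m"

definition cinner :: "complex^'m \<Rightarrow> complex^'m \<Rightarrow> complex"
  where "cinner v w = (\<Sum>i\<in>UNIV. cnj (v $ i) * w $ i)"

definition dagger :: "complex^'m^'k \<Rightarrow> complex^'k^'m"  ("_\<dagger>" [1000] 999)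
  where "A\<dagger> = (\<chi> i j. cnj (A $ j $ i))"

definition smul :: "complex \<Rightarrow> complex^'m^'k \<Rightarrow> complex^'m^'k"  (infixr "*\<^sub>C" 75)
  where "c *\<^sub>C A = (\<chi> i j. c * A $ i $ j)"

definition hermitian :: "('m::finite) op \<Rightarrow> bool"
  where "hermitian A \<longleftrightarrow> A\<dagger> = A"

definition commutator :: "('m::finite) op \<Rightarrow> 'm op \<Rightarrow> 'm op"
  where "commutator A B = A ** B - B ** A"

definition anticommutator :: "('m::finite) op \<Rightarrow> 'm op \<Rightarrow> 'm op"
  where "anticommutator A B = A ** B + B ** A"

definition positive_op :: "('m::finite) op \<Rightarrow> bool"
  where "positive_op A \<longleftrightarrow> (\<forall>v. cinner v (A *v v) \<in> \<real>\<^sub>\<ge>\<^sub>0)"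

definition density_op :: "('m::finite) op \<Rightarrow> bool"
  where "density_op \<rho> \<longleftrightarrow> positive_op \<rho> \<and> trace \<rho> = 1"

definition subnormalised :: "('m::finite) op \<Rightarrow> bool"
  where "subnormalised \<rho> \<longleftrightarrow> positive_op \<rho> \<and> Re (trace \<rho>) \<le> 1"


section \<open>Channels\<close>

text \<open>Complete positivity is positivity of \<open>id\<^sub>n \<otimes> \<Phi>\<close> for every \<open>n\<close>. As \<open>n\<close> is quantified inside the
  definition, an operator on \<open>\<complex>\<^sup>n \<otimes> \<H>\<close> is an \<open>n\<close> by \<open>n\<close> array of blocks \<open>X a b\<close> on \<open>\<H>\<close>, and a vector is
  a family \<open>v a\<close>, with \<open>a, b < n\<close>.\<close>

definition block_positive :: "nat \<Rightarrow> (nat \<Rightarrow> nat \<Rightarrow> ('m::finite) op) \<Rightarrow> bool"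
  where "block_positive n X \<longleftrightarrow>
    (\<forall>v :: nat \<Rightarrow> complex^'m. (\<Sum>a<n. \<Sum>b<n. cinner (v a) (X a b *v v b)) \<in> \<real>\<^sub>\<ge>\<^sub>0)"

definition completely_positive :: "(('m::finite) op \<Rightarrow> 'm op) \<Rightarrow> bool"
  where "completely_positive \<Phi> \<longleftrightarrow>
    (\<forall>n X. block_positive n X \<longrightarrow> block_positive n (\<lambda>a b. \<Phi> (X a b)))"

definition channel :: "(('m::finite) op \<Rightarrow> 'm op) \<Rightarrow> bool"
  where "channel \<Phi> \<longleftrightarrow> Vector_Spaces.linear (*\<^sub>C) (*\<^sub>C) \<Phi> \<and> completely_positive \<Phi> \<and>
    (\<forall>X. trace (\<Phi> X) = trace X)"

text \<open>The exponential \<open>e\<^bsup>t\<L>\<^esup>\<close> of a linear map, as a power series evaluated pointwise (linear maps carry no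
  Banach algebra instance to which the library function \<open>exp\<close> would apply).\<close>

definition exp_map :: "real \<Rightarrow> (('m::finite) op \<Rightarrow> 'm op) \<Rightarrow> 'm op \<Rightarrow> 'm op"
  where "exp_map t \<L> X = (\<Sum>n. (t ^ n / fact n) *\<^sub>R (\<L> ^^ n) X)"

definition dissipator :: "('m::finite) op \<Rightarrow> 'm op \<Rightarrow> 'm op"
  where "dissipator A X = A ** X ** A\<dagger> - (1/2) *\<^sub>C anticommutator (A\<dagger> ** A) X"

definition lindblad ::
    "nat \<Rightarrow> ('m::finite) op \<Rightarrow> (nat \<Rightarrow> 'm op) \<Rightarrow> (nat \<Rightarrow> 'm op) \<Rightarrow> 'm op \<Rightarrow> 'm op"
  where "lindblad N\<^sub>L H L J X = (- \<i>) *\<^sub>C commutator H X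
    + (\<Sum>j=1..N\<^sub>L. dissipator (L j) X) + (\<Sum>j=1..N\<^sub>L. dissipator (J j) X)"


section \<open>Clockwork and register\<close>

text \<open>The index type \<open>'n reg\<close> of the register has the elements \<open>0, \<dots>, N\<^sub>T\<close> where \<open>N\<^sub>T = CARD('n)\<close>. All
  types being inhabited, \<open>N\<^sub>T\<close> ranges over exactly the positive naturals as \<open>'n\<close> ranges over the
  finite types.\<close>

typedef ('n::finite) reg = "{0..CARD('n)}"
  by auto

instance reg :: (finite) finite
proof
  have "(UNIV :: 'a reg set) = Abs_reg ` {0..CARD('a)}"
    using type_definition.Abs_image[OF type_definition_reg] by metis
  then show "finite (UNIV :: 'a reg set)"
    by (metis finite_atLeastAtMost finite_imageI)
qed

text \<open>Kets are defined for all integers, with the periodic identification \<open>|n\<rangle> = |n mod (N\<^sub>T + 1)\<rangle>\<close>. For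
  the cut-off register only labels in \<open>0, \<dots>, N\<^sub>T\<close> are ever used.\<close>

definition ket :: "int \<Rightarrow> complex^('n::finite) reg"
  where "ket n = axis (Abs_reg (nat (n mod (int CARD('n) + 1)))) 1"

definition ketbra :: "int \<Rightarrow> int \<Rightarrow> ('n::finite) reg op"
  where "ketbra m n = (\<chi> i j. ket m $ i * cnj (ket n $ j))"

type_synonym ('c, 'n) joint_op = "('c \<times> 'n reg) op"

definition tensor :: "('c::finite) op \<Rightarrow> ('n::finite) reg op \<Rightarrow> ('c, 'n) joint_op"  (infixl "\<otimes>" 80)
  where "A \<otimes> B = (\<chi> p q. A $ fst p $ fst q * B $ snd p $ snd q)"

definition tr_R :: "('c::finite, 'n::finite) joint_op \<Rightarrow> 'c op"
  where "tr_R X = (\<chi> i j. \<Sum>r\<in>UNIV. X $ (i, r) $ (j, r))"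

definition tr_C :: "('c::finite, 'n::finite) joint_op \<Rightarrow> 'n reg op"
  where "tr_C X = (\<chi> r s. \<Sum>i\<in>UNIV. X $ (i, r) $ (i, s))"


section \<open>Ticking clocks\<close>

text \<open>A family \<open>M\<close> of maps is indexed by \<open>real\<close>, but only its members at times \<open>t \<ge> 0\<close> are meaningful.\<close>

type_synonym ('c, 'n) evolution = "real \<Rightarrow> ('c, 'n) joint_op \<Rightarrow> ('c, 'n) joint_op"

definition channel_family :: "('c::finite, 'n::finite) evolution \<Rightarrow> bool"
  where "channel_family M \<longleftrightarrow> (\<forall>t\<ge>0. channel (M t))"

definition from_tick ::
    "('c::finite, 'n::finite) evolution \<Rightarrow> nat \<Rightarrow> real \<Rightarrow> 'c op \<Rightarrow> ('c, 'n) joint_op"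
  where "from_tick M k t \<rho> = M t (\<rho> \<otimes> ketbra (int k) (int k))"

definition time_invariant :: "('c::finite, 'n::finite) evolution \<Rightarrow> bool"
  where "time_invariant M \<longleftrightarrow>
    (\<forall>t\<ge>0. \<forall>\<rho>. density_op \<rho> \<longrightarrow>
      (\<forall>l::int. \<forall>k\<in>{0..CARD('n)}. \<forall>k'\<in>{0..CARD('n)}.
        int k + l \<in> {0..int CARD('n)} \<longrightarrow> int k' + l \<in> {0..int CARD('n)} \<longrightarrow>
        tr_R (from_tick M k t \<rho> ** (mat 1 \<otimes> ketbra (int k + l) (int k + l))) =
        tr_R (from_tick M k' t \<rho> ** (mat 1 \<otimes> ketbra (int k' + l) (int k' + l)))))"

definition self_timed :: "('c::finite, 'n::finite) evolution \<Rightarrow> bool"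
  where "self_timed M \<longleftrightarrow> (\<forall>t\<^sub>1\<ge>0. \<forall>t\<^sub>2\<ge>0. M (t\<^sub>1 + t\<^sub>2) = M t\<^sub>2 \<circ> M t\<^sub>1)"

text \<open>Here \<open>onorm\<close> is the operator norm induced by the Hilbert-Schmidt norm. In finite dimension every
  other norm on linear maps gives the same limit.\<close>

definition zeroth_order :: "('c::finite, 'n::finite) evolution \<Rightarrow> bool"
  where "zeroth_order M \<longleftrightarrow> M 0 = id \<and> ((\<lambda>t. onorm (\<lambda>X. M t X - X)) \<longlongrightarrow> 0) (at_right 0)"

definition tick_prob :: "('c::finite, 'n::finite) evolution \<Rightarrow> nat \<Rightarrow> 'c op \<Rightarrow> nat \<Rightarrow> real \<Rightarrow> complex"
  where "tick_prob M k \<rho> l t = trace (from_tick M k t \<rho> ** (mat 1 \<otimes> ketbra (int l) (int l)))"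

text \<open>Since \<open>x / 0 = 0\<close> in HOL, it has to be said explicitly that the quotient is defined near \<open>0\<close>.\<close>

definition leading_order :: "('c::finite, 'n::finite) evolution \<Rightarrow> bool"
  where "leading_order M \<longleftrightarrow>
    (\<forall>k\<in>{0..CARD('n)}. \<forall>\<rho>. density_op \<rho> \<longrightarrow>
      (let f = (k + 1) mod (CARD('n) + 1) in
        (\<forall>\<^sub>F t in at_right 0. tick_prob M k \<rho> f t \<noteq> 0) \<and>
        ((\<lambda>t. (\<Sum>l\<in>{0..CARD('n)} - {k, f}. tick_prob M k \<rho> l t) / tick_prob M k \<rho> f t)
          \<longlongrightarrow> 0) (at_right 0)))"

definition periodic_evolution :: "('c::finite, 'n::finite) evolution \<Rightarrow> bool"
  where "periodic_evolution M \<longleftrightarrow>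
    channel_family M \<and> time_invariant M \<and> self_timed M \<and> zeroth_order M \<and> leading_order M"

text \<open>\<open>underlying_periodic M M'\<close>: the periodic channel family \<open>M'\<close> witnesses the cut-off condition for \<open>M\<close>.\<close>

definition underlying_periodic ::
    "('c::finite, 'n::finite) evolution \<Rightarrow> ('c, 'n) evolution \<Rightarrow> bool"
  where "underlying_periodic M M' \<longleftrightarrow> periodic_evolution M' \<and>
    (\<forall>\<rho>. density_op \<rho> \<longrightarrow>
      (\<forall>k<CARD('n). (\<lambda>t. norm (from_tick M k t \<rho> - from_tick M' k t \<rho>)) \<in> o[at_right 0](\<lambda>t. t)) \<and>
      (\<lambda>t. norm (tr_C (from_tick M CARD('n) t \<rho>) - ketbra (int CARD('n)) (int CARD('n))))
        \<in> o[at_right 0](\<lambda>t. t))"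

definition cutoff_evolution :: "('c::finite, 'n::finite) evolution \<Rightarrow> bool"
  where "cutoff_evolution M \<longleftrightarrow>
    channel_family M \<and> self_timed M \<and> (\<exists>M'. underlying_periodic M M')"

type_synonym ('c, 'n) clock = "('c, 'n) joint_op \<times> ('c, 'n) evolution"

definition periodic_clock :: "('c::finite, 'n::finite) clock \<Rightarrow> bool"
  where "periodic_clock C \<longleftrightarrow> density_op (fst C) \<and> periodic_evolution (snd C)"

definition cutoff_clock :: "('c::finite, 'n::finite) clock \<Rightarrow> bool"
  where "cutoff_clock C \<longleftrightarrow> density_op (fst C) \<and> cutoff_evolution (snd C)"

definition classical_register :: "('c::finite, 'n::finite) evolution \<Rightarrow> bool"
  where "classical_register M \<longleftrightarrow>
    (\<forall>t\<ge>0. \<forall>k\<in>{0..CARD('n)}. \<forall>\<rho>. density_op \<rho> \<longrightarrow>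
      (\<exists>\<sigma> :: nat \<Rightarrow> 'c op. (\<forall>n\<in>{0..CARD('n)}. subnormalised (\<sigma> n)) \<and>
        from_tick M k t \<rho> = (\<Sum>n=0..CARD('n). \<sigma> n \<otimes> ketbra (int n) (int n))))"

definition clockwork_channel ::
    "('c::finite, 'n::finite) evolution \<Rightarrow> nat \<Rightarrow> real \<Rightarrow> 'c op \<Rightarrow> 'c op"
  where "clockwork_channel M k t X = tr_R (from_tick M k t X)"

text \<open>The underlying periodic channel family is only asserted to exist, and need not be unique. That two
  clocks have the same one is expressed by letting every family that underlies one clock underlie the
  other. As both are clocks, such families exist.\<close>

definition clockwork_equivalent ::
    "('c::finite, 'n::finite) clock \<Rightarrow> ('c, 'n) clock \<Rightarrow> bool"
  where "clockwork_equivalent C C' \<longleftrightarrow> cutoff_clock C \<and> cutoff_clock C' \<and>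
    (\<forall>M. underlying_periodic (snd C) M \<longleftrightarrow> underlying_periodic (snd C') M) \<and>
    (\<exists>t\<ge>0. \<exists>\<rho>. density_op \<rho> \<and>
      tr_R (from_tick (snd C) CARD('n) t \<rho>) \<noteq> tr_R (from_tick (snd C') CARD('n) t \<rho>))"


section \<open>The generator\<close>

text \<open>\<open>l = 1\<close> for the periodic and \<open>l = 0\<close> for the cut-off register.\<close>

definition advance :: "complex \<Rightarrow> ('n::finite) reg op"
  where "advance l =
    (\<Sum>n=0..CARD('n) - 1. ketbra (int n + 1) (int n)) + l *\<^sub>C ketbra 0 (int CARD('n))"

definition clock_generator ::
    "complex \<Rightarrow> nat \<Rightarrow> ('c::finite) op \<Rightarrow> (nat \<Rightarrow> 'c op) \<Rightarrow> (nat \<Rightarrow> 'c op)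
      \<Rightarrow> ('c, 'n::finite) joint_op \<Rightarrow> ('c, 'n) joint_op"
  where "clock_generator l N\<^sub>L H L J =
    lindblad N\<^sub>L (H \<otimes> mat 1) (\<lambda>j. L j \<otimes> mat 1) (\<lambda>j. J j \<otimes> advance l)"

text \<open>\<open>autonomous_clockwork\<close>: the clockwork channel is \<open>e\<^bsup>t\<L>\<^esup>\<close> for every initial register label, hence
  independent of that label.\<close>

definition autonomous_clockwork ::
    "('c::finite, 'n::finite) evolution \<Rightarrow> ('c op \<Rightarrow> 'c op) \<Rightarrow> bool"
  where "autonomous_clockwork M \<L> \<longleftrightarrow>
    (\<forall>t\<ge>0. \<forall>k\<in>{0..CARD('n)}. clockwork_channel M k t = exp_map t \<L>)"

text \<open>Pitfall. Clockwork equivalence is irreflexive: it demands that the two clockwork states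
  differ for some input \<open>|N\<^sub>T\<rangle>\<langle>N\<^sub>T|\<close>. If the dissipators of the \<open>J j\<close> sum to zero (for instance if all
  \<open>J j\<close> are multiples of the identity, and always if the clockwork is one-dimensional), the cut-off
  clock generated by \<open>clock_generator 0\<close> already satisfies
  \<open>autonomous_clockwork M (lindblad N\<^sub>L H L J)\<close>, so any other clock satisfying it has the same
  clockwork states and cannot be clockwork equivalent to the first. A clock with the
  autonomous clockwork is therefore obtained only up to equality or clockwork equivalence.\<close>

end

theory Submission
  imports Defs
begin

text \<open>Partial tracing turns the dissipator of \<open>A \<otimes> B\<close> into that of \<open>A\<close>, weighted by \<open>B\<^sup>\<dagger> B\<close>. For the periodic
  register \<open>B\<close> is unitary, so \<open>tr\<^sub>R\<close> intertwines the two generators and hence their exponentials. For the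
  cut-off register \<open>B\<^sup>\<dagger> B = 1 - |N\<^sub>T\<rangle>\<langle>N\<^sub>T|\<close>, and the missing weight is restored by letting the jumps
  \<open>J\<^sub>j\<close> go on, without moving the register, once the last tick is reached: the dissipators of
  \<open>J\<^sub>j \<otimes> |N\<^sub>T\<rangle>\<langle>N\<^sub>T|\<close> are added to the generator. They vanish on the earlier ticks and are traceless on the
  clockwork, so to first order in \<open>t\<close> neither cut-off condition notices them. If the two clocks agreed
  on all inputs \<open>\<rho> \<otimes> |N\<^sub>T\<rangle>\<langle>N\<^sub>T|\<close>, then differentiating at \<open>t = 0\<close> would give \<open>\<Sum>\<^sub>j D(J\<^sub>j) = 0\<close>, and then the
  original clock has the required clockwork channel already.

  That the new evolution is completely positive is the easy half of the theorem of Gorini, Kossakowski,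
  Sudarshan and Lindblad: \<open>\<L> X = \<Phi> X + G X + X G\<^sup>\<dagger>\<close> is the limit for \<open>\<epsilon> \<rightarrow> 0\<close> of
  \<open>\<L> X + \<epsilon> G X G\<^sup>\<dagger> = \<Phi> X + A X A\<^sup>\<dagger> - X / \<epsilon>\<close> with \<open>A = \<surd>\<epsilon> G + 1 / \<surd>\<epsilon>\<close>, whose exponential is a positive multiple
  of the exponential of a completely positive map.\<close>

section \<open>The exponential of a linear map\<close>

text \<open>The bounded linear endomorphisms have no multiplication as a library type. A copy of them with
  composition as product is a Banach algebra, to which \<open>exp\<close> and its laws apply.\<close>

typedef (overloaded) 'a endo = "UNIV :: ('a::{real_normed_vector,perfect_space} \<Rightarrow>\<^sub>L 'a) set"
  morphisms blinfun_of_endo endo_of_blinfun ..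

setup_lifting type_definition_endo

instantiation endo :: ("{real_normed_vector,perfect_space}") real_algebra_1
begin

lift_definition zero_endo :: "'a endo" is 0 .
lift_definition one_endo :: "'a endo" is id_blinfun .
lift_definition plus_endo :: "'a endo \<Rightarrow> 'a endo \<Rightarrow> 'a endo" is "(+)" .
lift_definition minus_endo :: "'a endo \<Rightarrow> 'a endo \<Rightarrow> 'a endo" is "(-)" .
lift_definition uminus_endo :: "'a endo \<Rightarrow> 'a endo" is uminus .
lift_definition times_endo :: "'a endo \<Rightarrow> 'a endo \<Rightarrow> 'a endo" is "(o\<^sub>L)" .
lift_definition scaleR_endo :: "real \<Rightarrow> 'a endo \<Rightarrow> 'a endo" is "(*\<^sub>R)" .

instance
proof
  fix a b c :: "'a endo" and r s :: real
  show "(a + b) + c = a + (b + c)" by transfer (rule add.assoc)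
  show "a + b = b + a" by transfer (rule add.commute)
  show "0 + a = a" by transfer simp
  show "- a + a = 0" by transfer simp
  show "a - b = a + - b" by transfer simp
  show "r *\<^sub>R (a + b) = r *\<^sub>R a + r *\<^sub>R b" by transfer (rule scaleR_add_right)
  show "(r + s) *\<^sub>R a = r *\<^sub>R a + s *\<^sub>R a" by transfer (rule scaleR_add_left)
  show "r *\<^sub>R s *\<^sub>R a = (r * s) *\<^sub>R a" by transfer simp
  show "1 *\<^sub>R a = a" by transfer simp
  show "(a * b) * c = a * (b * c)" by transfer (simp add: blinfun_eqI)
  show "(a + b) * c = a * c + b * c" by transfer (simp add: blinfun_eqI blinfun.bilinear_simps)
  show "a * (b + c) = a * b + a * c" by transfer (simp add: blinfun_eqI blinfun.bilinear_simps)
  show "r *\<^sub>R a * b = r *\<^sub>R (a * b)" by transfer (simp add: blinfun_eqI blinfun.bilinear_simps)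
  show "a * r *\<^sub>R b = r *\<^sub>R (a * b)" by transfer (simp add: blinfun_eqI blinfun.bilinear_simps)
  show "1 * a = a" by transfer (simp add: blinfun_eqI)
  show "a * 1 = a" by transfer (simp add: blinfun_eqI)
  \<comment> \<open>\<open>perfect_space\<close> excludes the zero space, so the identity has norm 1
    and differs from 0.\<close>
  have "(0 :: 'a \<Rightarrow>\<^sub>L 'a) \<noteq> id_blinfun"
    by (rule notI, drule arg_cong[of _ _ norm]) simp
  then show "(0 :: 'a endo) \<noteq> 1" by transfer
qed

end

instantiation endo :: ("{real_normed_vector,perfect_space}") real_normed_algebra_1
begin

lift_definition norm_endo :: "'a endo \<Rightarrow> real" is norm .

definition sgn_endo :: "'a endo \<Rightarrow> 'a endo"
  where "sgn_endo f = f /\<^sub>R norm f"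
definition dist_endo :: "'a endo \<Rightarrow> 'a endo \<Rightarrow> real"
  where "dist_endo f g = norm (f - g)"

definition uniformity_endo :: "('a endo \<times> 'a endo) filter"
  where "uniformity_endo = (INF e\<in>{0<..}. principal {(f, g). dist f g < e})"
definition open_endo :: "'a endo set \<Rightarrow> bool"
  where "open_endo U \<longleftrightarrow> (\<forall>x\<in>U. \<forall>\<^sub>F (x', y) in uniformity. x' = x \<longrightarrow> y \<in> U)"

instance
proof
  fix a b :: "'a endo" and r :: real
  show "dist a b = norm (a - b)" by (rule dist_endo_def)
  show "sgn a = a /\<^sub>R norm a" by (rule sgn_endo_def)
  show "(uniformity :: ('a endo \<times> 'a endo) filter) =
      (INF e\<in>{0<..}. principal {(f, g). dist f g < e})"
    by (rule uniformity_endo_def)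
  show "open U \<longleftrightarrow> (\<forall>x\<in>U. \<forall>\<^sub>F (x', y) in uniformity. x' = x \<longrightarrow> y \<in> U)" for U :: "'a endo set"
    by (rule open_endo_def)
  show "norm a = 0 \<longleftrightarrow> a = 0" by transfer simp
  show "norm (a + b) \<le> norm a + norm b" by transfer (rule norm_triangle_ineq)
  show "norm (r *\<^sub>R a) = \<bar>r\<bar> * norm a" by transfer simp
  show "norm (a * b) \<le> norm a * norm b" by transfer (rule norm_blinfun_compose)
  show "norm (1 :: 'a endo) = 1" by transfer simp
qed

end

text \<open>Being continuous, the embedding carries limits over from the bounded linear maps;
  completeness is inherited this way below.\<close>

lemma bounded_linear_endo_of_blinfun: "bounded_linear endo_of_blinfun"
proof
  fix f g :: "'a \<Rightarrow>\<^sub>L 'a" and r :: real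
  show "endo_of_blinfun (f + g) = endo_of_blinfun f + endo_of_blinfun g"
    by (simp add: plus_endo.abs_eq)
  show "endo_of_blinfun (r *\<^sub>R f) = r *\<^sub>R endo_of_blinfun f"
    by (simp add: scaleR_endo.abs_eq)
  show "\<exists>K. \<forall>f :: 'a \<Rightarrow>\<^sub>L 'a. norm (endo_of_blinfun f) \<le> norm f * K"
    by (intro exI[of _ 1]) (simp add: norm_endo.abs_eq)
qed

instance endo :: ("{banach,perfect_space}") banach
proof
  fix X :: "nat \<Rightarrow> 'a endo"
  assume "Cauchy X"
  then have "Cauchy (\<lambda>n. blinfun_of_endo (X n))"
    by (simp add: Cauchy_def dist_norm norm_endo.rep_eq minus_endo.rep_eq)
  then obtain f where "(\<lambda>n. blinfun_of_endo (X n)) \<longlonglongrightarrow> f"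
    using Cauchy_convergent convergent_def by blast
  then have "(\<lambda>n. endo_of_blinfun (blinfun_of_endo (X n))) \<longlonglongrightarrow> endo_of_blinfun f"
    by (rule bounded_linear.tendsto[OF bounded_linear_endo_of_blinfun])
  then show "convergent X"
    by (auto simp: blinfun_of_endo_inverse convergent_def)
qed

definition endo_apply :: "'a::{real_normed_vector,perfect_space} endo \<Rightarrow> 'a \<Rightarrow> 'a"
  where "endo_apply a = blinfun_apply (blinfun_of_endo a)"

lemma bounded_bilinear_endo_apply: "bounded_bilinear endo_apply"
proof
  fix a b :: "'a endo" and x y :: 'a and r :: real
  show "endo_apply (a + b) x = endo_apply a x + endo_apply b x"
    by (simp add: endo_apply_def plus_endo.rep_eq blinfun.bilinear_simps)
  show "endo_apply a (x + y) = endo_apply a x + endo_apply a y"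
    by (simp add: endo_apply_def blinfun.bilinear_simps)
  show "endo_apply (r *\<^sub>R a) x = r *\<^sub>R endo_apply a x"
    by (simp add: endo_apply_def scaleR_endo.rep_eq blinfun.bilinear_simps)
  show "endo_apply a (r *\<^sub>R x) = r *\<^sub>R endo_apply a x"
    by (simp add: endo_apply_def blinfun.bilinear_simps)
  show "\<exists>K. \<forall>(a :: 'a endo) x. norm (endo_apply a x) \<le> norm a * norm x * K"
    by (intro exI[of _ 1]) (simp add: endo_apply_def norm_endo.rep_eq norm_blinfun)
qed

lemma endo_apply_one [simp]: "endo_apply 1 x = x"
  by (simp add: endo_apply_def one_endo.rep_eq)

lemma endo_apply_times [simp]: "endo_apply (a * b) x = endo_apply a (endo_apply b x)"
  by (simp add: endo_apply_def times_endo.rep_eq)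

lemma endo_apply_power: "endo_apply (a ^ n) x = (endo_apply a ^^ n) x"
  by (induction n) simp_all

text \<open>\<open>Blinfun\<close> is meaningful only at bounded linear maps, so passing from
  \<open>f\<close> to \<open>endo f\<close> goes along with a proof of
  \<open>bounded_linear f\<close>.\<close>

definition endo :: "('a::{real_normed_vector,perfect_space} \<Rightarrow> 'a) \<Rightarrow> 'a endo"
  where "endo f = endo_of_blinfun (Blinfun f)"

lemma endo_apply_endo: "bounded_linear f \<Longrightarrow> endo_apply (endo f) = f"
  by (simp add: endo_def endo_apply_def endo_of_blinfun_inverse bounded_linear_Blinfun_apply)

lemma endo_eqI: "(\<And>x. endo_apply a x = endo_apply b x) \<Longrightarrow> a = b"
  by (metis blinfun_eqI blinfun_of_endo_inject endo_apply_def)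

text \<open>Evaluation at \<open>X\<close> is a bounded linear function of the endomorphism, so it
  passes through the convergent series of \<open>exp\<close>. This links the pointwise series to the
  Banach algebra.\<close>

lemma exp_map_sums:
  fixes \<L> :: "('m::finite) op \<Rightarrow> 'm op"
  assumes "bounded_linear \<L>"
  shows "(\<lambda>n. (t ^ n / fact n) *\<^sub>R (\<L> ^^ n) X) sums endo_apply (exp (t *\<^sub>R endo \<L>)) X"
proof -
  interpret bounded_bilinear "endo_apply :: 'm op endo \<Rightarrow> _"
    by (rule bounded_bilinear_endo_apply)
  have "(\<lambda>n. (t *\<^sub>R endo \<L>) ^ n /\<^sub>R fact n) sums exp (t *\<^sub>R endo \<L>)"
    by (rule exp_converges)
  then have "(\<lambda>n. endo_apply ((t *\<^sub>R endo \<L>) ^ n /\<^sub>R fact n) X) sums endo_apply (exp (t *\<^sub>R endo \<L>)) X"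
    by (rule bounded_linear.sums[OF bounded_linear_left])
  then show ?thesis
    by (simp add: scaleR_left endo_apply_power endo_apply_endo[OF assms] divide_inverse mult.commute)
qed

lemma exp_map_eq_exp:
  "bounded_linear \<L> \<Longrightarrow> exp_map t \<L> = endo_apply (exp (t *\<^sub>R endo \<L>))"
  by (rule ext) (simp add: exp_map_def sums_unique[OF exp_map_sums])

lemma bounded_linear_exp_map: "bounded_linear \<L> \<Longrightarrow> bounded_linear (exp_map t \<L>)"
  by (simp add: exp_map_eq_exp bounded_bilinear.bounded_linear_right[OF bounded_bilinear_endo_apply])

lemma exp_map_add:
  assumes "bounded_linear \<L>"
  shows "exp_map (s + t) \<L> = exp_map t \<L> \<circ> exp_map s \<L>"
proof
  fix X
  have "exp ((s + t) *\<^sub>R endo \<L>) = exp (t *\<^sub>R endo \<L>) * exp (s *\<^sub>R endo \<L>)"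
    by (simp add: exp_add_commuting[symmetric] algebra_simps)
  then show "exp_map (s + t) \<L> X = (exp_map t \<L> \<circ> exp_map s \<L>) X"
    by (simp add: exp_map_eq_exp[OF assms])
qed

text \<open>A scalar multiple of the identity commutes with \<open>\<L>\<close>, so its exponential
  splits off as a positive number. This absorbs the term \<open>- X / \<epsilon>\<close> in the
  proof of complete positivity.\<close>

lemma exp_map_shift:
  assumes "bounded_linear \<L>"
  shows "exp_map t (\<lambda>X. \<L> X - c *\<^sub>R X) X = exp (- (c * t)) *\<^sub>R exp_map t \<L> X"
proof -
  interpret bounded_bilinear "endo_apply :: 'a op endo \<Rightarrow> _"
    by (rule bounded_bilinear_endo_apply)
  have bl: "bounded_linear (\<lambda>X. \<L> X - c *\<^sub>R X)"
    by (intro bounded_linear_sub assms bounded_linear_scaleR_right)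
  have "endo (\<lambda>X. \<L> X - c *\<^sub>R X) = endo \<L> - of_real c"
    by (rule endo_eqI)
      (simp add: diff_left of_real_def scaleR_left endo_apply_endo[OF bl] endo_apply_endo[OF assms])
  then have "exp (t *\<^sub>R endo (\<lambda>X. \<L> X - c *\<^sub>R X)) = exp (t *\<^sub>R endo \<L> + of_real (- (c * t)))"
    by (simp add: scaleR_diff_right of_real_def mult.commute)
  also have "\<dots> = exp (t *\<^sub>R endo \<L>) * exp (of_real (- (c * t)))"
    by (rule exp_add_commuting) (simp add: scaleR_conv_of_real[symmetric] of_real_def)
  also have "\<dots> = exp (- (c * t)) *\<^sub>R exp (t *\<^sub>R endo \<L>)"
    by (simp only: exp_of_real) (simp add: of_real_def)
  finally show ?thesis
    by (simp add: exp_map_eq_exp[OF bl] exp_map_eq_exp[OF assms] scaleR_left)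
qed

text \<open>\<open>T\<close> turns powers of \<open>\<L>\<close> into powers of \<open>\<L>'\<close>
  and, being continuous, passes through the series. It is applied to the partial trace
  \<open>tr_R\<close> and to multiplication by a complex scalar.\<close>

lemma exp_map_intertwine:
  assumes "bounded_linear \<L>" "bounded_linear \<L>'" "bounded_linear T"
    and comm: "\<And>X. T (\<L> X) = \<L>' (T X)"
  shows "T (exp_map t \<L> X) = exp_map t \<L>' (T X)"
proof -
  have "T ((\<L> ^^ n) X) = (\<L>' ^^ n) (T X)" for n
    by (induction n) (simp_all add: comm)
  then have "(\<lambda>n. (t ^ n / fact n) *\<^sub>R (\<L>' ^^ n) (T X)) sums T (exp_map t \<L> X)"
    using bounded_linear.sums[OF assms(3) exp_map_sums[OF assms(1), of t X]]
    by (simp add: linear_cmul[OF bounded_linear.linear[OF assms(3)]] exp_map_eq_exp[OF assms(1)])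
  then show ?thesis
    by (simp add: exp_map_def[of t \<L>'] sums_iff)
qed

lemma exp_map_has_vector_derivative:
  assumes "bounded_linear \<L>"
  shows "((\<lambda>t. exp_map t \<L> X) has_vector_derivative \<L> X) (at 0)"
proof -
  interpret bounded_bilinear "endo_apply :: 'a op endo \<Rightarrow> _"
    by (rule bounded_bilinear_endo_apply)
  have "((\<lambda>t. exp (t *\<^sub>R endo \<L>)) has_vector_derivative exp (0 *\<^sub>R endo \<L>) * endo \<L>) (at 0)"
    by (rule exp_scaleR_has_vector_derivative_right)
  from bounded_linear.has_vector_derivative[OF bounded_linear_left this, of X]
  show ?thesis
    by (simp add: exp_map_eq_exp[OF assms] endo_apply_endo[OF assms])
qed

lemma exp_map_0: "bounded_linear \<L> \<Longrightarrow> exp_map 0 \<L> X = X"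
  by (simp add: exp_map_eq_exp)

text \<open>On the ball of radius \<open>norm a + 1\<close> the series is dominated by the real
  exponential series at that radius, so it converges uniformly there and its sum is
  continuous.\<close>

lemma isCont_exp_endo: "isCont exp (a :: 'b::{real_normed_algebra_1,banach})"
proof -
  let ?r = "norm a + 1"
  have "continuous_on (ball 0 ?r) (\<lambda>x::'b. \<Sum>n. x ^ n /\<^sub>R fact n)"
  proof (rule uniform_limit_theorem[OF _ Weierstrass_m_test])
    show "\<forall>\<^sub>F n in sequentially. continuous_on (ball 0 ?r) (\<lambda>x::'b. \<Sum>i<n. x ^ i /\<^sub>R fact i)"
      by (intro always_eventually allI continuous_intros)
    show "norm (x ^ n /\<^sub>R fact n) \<le> ?r ^ n /\<^sub>R fact n" if "x \<in> ball 0 ?r" for n and x :: 'b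
    proof -
      have "norm (x ^ n) \<le> ?r ^ n"
        using that by (intro order_trans[OF norm_power_ineq] power_mono) auto
      then show ?thesis by (simp add: divide_simps)
    qed
    show "summable (\<lambda>n. ?r ^ n /\<^sub>R fact n)" by (rule summable_exp_generic)
  qed simp
  then show ?thesis
    unfolding exp_def
    by (simp add: continuous_on_eq_continuous_at[OF open_ball])
qed

text \<open>The perturbed endomorphism is affine in \<open>\<epsilon>\<close>, and both
  \<open>exp\<close> and evaluation are continuous.\<close>

lemma exp_map_perturb_tendsto:
  assumes "bounded_linear \<L>" "bounded_linear K"
  shows "((\<lambda>\<epsilon>. exp_map t (\<lambda>X. \<L> X + \<epsilon> *\<^sub>R K X) X) \<longlongrightarrow> exp_map t \<L> X) (at 0)"
proof -
  interpret bounded_bilinear "endo_apply :: 'a op endo \<Rightarrow> _"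
    by (rule bounded_bilinear_endo_apply)
  have bl: "bounded_linear (\<lambda>X. \<L> X + \<epsilon> *\<^sub>R K X)" for \<epsilon>
    by (intro bounded_linear_add assms bounded_linear_compose[OF bounded_linear_scaleR_right])
  have eq: "endo (\<lambda>X. \<L> X + \<epsilon> *\<^sub>R K X) = endo \<L> + \<epsilon> *\<^sub>R endo K" for \<epsilon>
    by (rule endo_eqI)
      (simp add: add_left scaleR_left endo_apply_endo[OF bl] endo_apply_endo assms)
  have "((\<lambda>\<epsilon>. t *\<^sub>R (endo \<L> + \<epsilon> *\<^sub>R endo K)) \<longlongrightarrow> t *\<^sub>R (endo \<L> + 0 *\<^sub>R endo K)) (at 0)"
    by (intro tendsto_intros)
  from isCont_tendsto_compose[OF isCont_exp_endo this]
  have "((\<lambda>\<epsilon>. exp (t *\<^sub>R (endo \<L> + \<epsilon> *\<^sub>R endo K))) \<longlongrightarrow> exp (t *\<^sub>R endo \<L>)) (at 0)"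
    by simp
  from tendsto[OF this tendsto_const[of X]]
  show ?thesis
    by (simp add: exp_map_eq_exp[OF bl] exp_map_eq_exp[OF assms(1)] eq)
qed


section \<open>Complete positivity of exponentials\<close>

lemma cinner_add_right: "cinner v (w + w') = cinner v w + cinner v w'"
  by (simp add: cinner_def distrib_left sum.distrib)

lemma cinner_scaleR_right: "cinner v (r *\<^sub>R w) = of_real r * cinner v w"
  by (simp add: cinner_def sum_distrib_left mult_ac scaleR_conv_of_real[symmetric])

lemma cinner_matrix_vector_mult: "cinner v (A *v w) = cinner (A\<dagger> *v v) w"
proof -
  have "cinner v (A *v w) = (\<Sum>i\<in>UNIV. \<Sum>j\<in>UNIV. cnj (v $ i) * (A $ i $ j * w $ j))"
    by (simp add: cinner_def matrix_vector_mult_def sum_distrib_left)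
  also have "\<dots> = (\<Sum>j\<in>UNIV. \<Sum>i\<in>UNIV. cnj (v $ i) * (A $ i $ j * w $ j))"
    by (rule sum.swap)
  also have "\<dots> = cinner (A\<dagger> *v v) w"
    by (simp add: cinner_def dagger_def matrix_vector_mult_def sum_distrib_left sum_distrib_right mult_ac)
  finally show ?thesis .
qed

lemma tendsto_cinner_matrix:
  fixes X :: "'b \<Rightarrow> ('m::finite) op"
  assumes "(X \<longlongrightarrow> Y) F"
  shows "((\<lambda>x. cinner v (X x *v w)) \<longlongrightarrow> cinner v (Y *v w)) F"
  unfolding cinner_def matrix_vector_mult_def
  by (auto intro!: tendsto_intros tendsto_vec_nth assms)

lemma dagger_dagger [simp]: "(A\<dagger>)\<dagger> = A"
  by (simp add: dagger_def vec_eq_iff)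

lemma dagger_mult: "(A ** B)\<dagger> = B\<dagger> ** A\<dagger>"
  by (simp add: dagger_def matrix_matrix_mult_def vec_eq_iff mult.commute)

lemma dagger_add: "(A + B)\<dagger> = A\<dagger> + B\<dagger>"
  by (simp add: dagger_def vec_eq_iff)

lemma dagger_minus: "(- A)\<dagger> = - A\<dagger>"
  by (simp add: dagger_def vec_eq_iff)

lemma dagger_scaleR: "(r *\<^sub>R A)\<dagger> = r *\<^sub>R A\<dagger>"
  by (simp add: dagger_def vec_eq_iff)

lemma dagger_smul: "(c *\<^sub>C A)\<dagger> = cnj c *\<^sub>C A\<dagger>"
  by (simp add: dagger_def smul_def vec_eq_iff)

lemma dagger_mat_1 [simp]: "(mat 1)\<dagger> = (mat 1 :: ('m::finite) op)"
  by (auto simp: dagger_def mat_def vec_eq_iff)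

lemma dagger_zero [simp]: "0\<dagger> = (0 :: complex^'m^'k)"
  by (simp add: dagger_def vec_eq_iff)

lemma smul_of_real: "of_real r *\<^sub>C A = r *\<^sub>R A"
  by (simp add: smul_def vec_eq_iff scaleR_conv_of_real[where 'a = complex])

lemma smul_one [simp]: "1 *\<^sub>C A = A"
  by (simp add: smul_def vec_eq_iff)

lemma smul_add_right: "c *\<^sub>C (A + B) = c *\<^sub>C A + c *\<^sub>C B"
  by (simp add: smul_def vec_eq_iff distrib_left)

lemma smul_mult_left: "(c *\<^sub>C A) ** B = c *\<^sub>C (A ** B)"
  by (simp add: smul_def matrix_matrix_mult_def vec_eq_iff sum_distrib_left mult.assoc)

lemma smul_mult_right: "A ** (c *\<^sub>C B) = c *\<^sub>C (A ** B)"
  by (simp add: smul_def matrix_matrix_mult_def vec_eq_iff sum_distrib_left mult_ac)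

lemma vector_space_smul: "vector_space ((*\<^sub>C) :: complex \<Rightarrow> complex^'m^'k \<Rightarrow> _)"
  by unfold_locales (simp_all add: smul_def vec_eq_iff algebra_simps)

abbreviation clinear :: "(complex^'m^'k \<Rightarrow> complex^'p^'q) \<Rightarrow> bool"
  where "clinear \<equiv> Vector_Spaces.linear (*\<^sub>C) (*\<^sub>C)"

lemma clinear_iff: "clinear f \<longleftrightarrow> (\<forall>X Y. f (X + Y) = f X + f Y) \<and> (\<forall>c X. f (c *\<^sub>C X) = c *\<^sub>C f X)"
  by (simp add: Vector_Spaces.linear_iff vector_space_smul)

text \<open>Real scalars are complex scalars, and linear maps in finite dimension are bounded. This
  bridges the linearity demanded of channels and the analysis of \<open>exp_map\<close>.\<close>

lemma clinear_imp_bounded_linear: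
  assumes "clinear f"
  shows "bounded_linear f"
proof -
  have "linear f"
    using assms by (intro linearI) (simp_all add: clinear_iff flip: smul_of_real)
  then show ?thesis
    by (simp add: linear_conv_bounded_linear)
qed

lemma clinear_add_fun: "clinear f \<Longrightarrow> clinear g \<Longrightarrow> clinear (\<lambda>X. f X + g X)"
  by (simp add: clinear_iff smul_add_right)

lemma bounded_bilinear_matrix_mult:
  "bounded_bilinear ((**) :: complex^'m^'k \<Rightarrow> complex^'p^'m \<Rightarrow> complex^'p^'k)"
proof -
  have "bilinear ((**) :: complex^'m^'k \<Rightarrow> complex^'p^'m \<Rightarrow> complex^'p^'k)"
    unfolding bilinear_def
    by (auto intro!: linearI
        simp: matrix_add_ldistrib smul_mult_left smul_mult_right smul_of_real[symmetric])
      (simp_all add: matrix_matrix_mult_def vec_eq_iff algebra_simps sum.distrib)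
  then show ?thesis
    by (simp add: bilinear_conv_bounded_bilinear)
qed

lemmas matrix_mult_simps =
  bounded_bilinear.add_left[OF bounded_bilinear_matrix_mult]
  bounded_bilinear.add_right[OF bounded_bilinear_matrix_mult]
  bounded_bilinear.diff_left[OF bounded_bilinear_matrix_mult]
  bounded_bilinear.diff_right[OF bounded_bilinear_matrix_mult]
  bounded_bilinear.minus_left[OF bounded_bilinear_matrix_mult]
  bounded_bilinear.minus_right[OF bounded_bilinear_matrix_mult]
  bounded_bilinear.zero_left[OF bounded_bilinear_matrix_mult]
  bounded_bilinear.zero_right[OF bounded_bilinear_matrix_mult]
  bounded_bilinear.scaleR_left[OF bounded_bilinear_matrix_mult]
  bounded_bilinear.scaleR_right[OF bounded_bilinear_matrix_mult]

lemma clinear_conjugation: "clinear (\<lambda>X. A ** X ** B)"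
  by (simp add: clinear_iff matrix_mult_simps smul_mult_left smul_mult_right)

section \<open>Closure properties of complete positivity\<close>

lemma block_positive_add:
  assumes "block_positive n X" "block_positive n Y"
  shows "block_positive n (\<lambda>a b. X a b + Y a b)"
  using assms unfolding block_positive_def
  by (simp add: matrix_vector_mult_add_rdistrib cinner_add_right sum.distrib nonneg_Reals_add_I)

lemma block_positive_scaleR:
  assumes "block_positive n X" "0 \<le> r"
  shows "block_positive n (\<lambda>a b. r *\<^sub>R X a b)"
proof -
  have scale: "(r *\<^sub>R A) *v w = r *\<^sub>R (A *v w)" for A :: "'a op" and w
    by (simp add: matrix_vector_mult_def vec_eq_iff scaleR_sum_right)
  show ?thesis
    using assms unfolding block_positive_def
    by (simp add: scale cinner_scaleR_right nonneg_Reals_mult_I flip: sum_distrib_left)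
qed

text \<open>For fixed vectors the form is continuous in the finitely many blocks, and the
  nonnegative reals are closed in the complex plane.\<close>

lemma block_positive_tendsto:
  fixes Y :: "nat \<Rightarrow> nat \<Rightarrow> ('m::finite) op"
  assumes "\<And>a b. ((\<lambda>x. X x a b) \<longlongrightarrow> Y a b) F"
    and "\<forall>\<^sub>F x in F. block_positive n (X x)" "F \<noteq> bot"
  shows "block_positive n Y"
  unfolding block_positive_def
proof
  fix v :: "nat \<Rightarrow> complex^'m"
  have "((\<lambda>x. \<Sum>a<n. \<Sum>b<n. cinner (v a) (X x a b *v v b)) \<longlongrightarrow>
      (\<Sum>a<n. \<Sum>b<n. cinner (v a) (Y a b *v v b))) F"
    by (intro tendsto_sum tendsto_cinner_matrix assms(1))
  moreover have "\<forall>\<^sub>F x in F. (\<Sum>a<n. \<Sum>b<n. cinner (v a) (X x a b *v v b)) \<in> \<real>\<^sub>\<ge>\<^sub>0"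
    using assms(2) by (rule eventually_mono) (simp add: block_positive_def)
  ultimately show "(\<Sum>a<n. \<Sum>b<n. cinner (v a) (Y a b *v v b)) \<in> \<real>\<^sub>\<ge>\<^sub>0"
    by (rule Lim_in_closed_set[OF closed_nonneg_Reals_complex _ assms(3), rotated])
qed

lemma completely_positive_zero: "completely_positive (\<lambda>X. 0)"
  by (simp add: completely_positive_def block_positive_def cinner_def)

lemma completely_positive_add:
  "completely_positive \<Phi> \<Longrightarrow> completely_positive \<Psi> \<Longrightarrow> completely_positive (\<lambda>X. \<Phi> X + \<Psi> X)"
  by (simp add: completely_positive_def block_positive_add)

lemma completely_positive_scaleR:
  "completely_positive \<Phi> \<Longrightarrow> 0 \<le> r \<Longrightarrow> completely_positive (\<lambda>X. r *\<^sub>R \<Phi> X)"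
  by (simp add: completely_positive_def block_positive_scaleR)

lemma completely_positive_sum:
  "(\<And>i. i \<in> I \<Longrightarrow> completely_positive (\<Phi> i)) \<Longrightarrow> completely_positive (\<lambda>X. \<Sum>i\<in>I. \<Phi> i X)"
  by (induction I rule: infinite_finite_induct)
    (simp_all add: completely_positive_zero completely_positive_add)

lemma completely_positive_funpow: "completely_positive \<Phi> \<Longrightarrow> completely_positive (\<Phi> ^^ n)"
  by (induction n) (simp_all add: completely_positive_def)

lemma completely_positive_tendsto:
  fixes \<Psi> :: "('m::finite) op \<Rightarrow> 'm op"
  assumes "\<And>X. ((\<lambda>x. \<Phi> x X) \<longlongrightarrow> \<Psi> X) F"
    and "\<forall>\<^sub>F x in F. completely_positive (\<Phi> x)" "F \<noteq> bot"
  shows "completely_positive \<Psi>"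
  unfolding completely_positive_def
proof (intro allI impI)
  fix n and X :: "nat \<Rightarrow> nat \<Rightarrow> 'm op"
  assume "block_positive n X"
  then have "\<forall>\<^sub>F x in F. block_positive n (\<lambda>a b. \<Phi> x (X a b))"
    using assms(2) by (auto simp: completely_positive_def elim: eventually_mono)
  then show "block_positive n (\<lambda>a b. \<Psi> (X a b))"
    by (rule block_positive_tendsto[rotated]) (fact assms)+
qed

text \<open>\<open>A\<close> and its adjoint move onto the vectors: the form at the family
  \<open>v a\<close> becomes that of \<open>X\<close> at the family
  \<open>A\<dagger> *v v a\<close>.\<close>

lemma completely_positive_conjugation: "completely_positive (\<lambda>X. A ** X ** A\<dagger>)"
  unfolding completely_positive_def
proof (intro allI impI)
  fix n and X :: "nat \<Rightarrow> nat \<Rightarrow> 'a op"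
  assume X: "block_positive n X"
  have "cinner v (A ** Y ** A\<dagger> *v w) = cinner (A\<dagger> *v v) (Y *v (A\<dagger> *v w))" for v w Y
    by (simp add: cinner_matrix_vector_mult flip: matrix_vector_mul_assoc)
  with X show "block_positive n (\<lambda>a b. A ** X a b ** A\<dagger>)"
    by (auto simp: block_positive_def)
qed

text \<open>For \<open>0 \<le> t\<close> the partial sums are nonnegative combinations of powers of
  \<open>\<Phi>\<close>, and complete positivity survives pointwise limits.\<close>

lemma completely_positive_exp_map:
  assumes "completely_positive \<Phi>" "bounded_linear \<Phi>" "0 \<le> t"
  shows "completely_positive (exp_map t \<Phi>)"
proof (rule completely_positive_tendsto[OF _ always_eventually sequentially_bot])
  show "(\<lambda>N. \<Sum>n<N. (t ^ n / fact n) *\<^sub>R (\<Phi> ^^ n) X) \<longlonglongrightarrow> exp_map t \<Phi> X" for X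
    using exp_map_sums[OF assms(2)] by (simp add: exp_map_eq_exp[OF assms(2)] sums_def)
  show "\<forall>N. completely_positive (\<lambda>X. \<Sum>n<N. (t ^ n / fact n) *\<^sub>R (\<Phi> ^^ n) X)"
    by (intro allI completely_positive_sum completely_positive_scaleR completely_positive_funpow)
      (simp_all add: assms)
qed

section \<open>Generators of completely positive semigroups\<close>

text \<open>The Gorini-Kossakowski-Sudarshan-Lindblad form, with no trace condition tying
  \<open>G\<close> to \<open>\<Phi>\<close>. It is stable under sums, so that the commutator and
  each dissipator can be handled separately; trace preservation enters in
  \<open>channel_exp_map\<close>.\<close>

definition cp_generator :: "(('m::finite) op \<Rightarrow> 'm op) \<Rightarrow> bool"
  where "cp_generator \<L> \<longleftrightarrow> (\<exists>\<Phi> G. completely_positive \<Phi> \<and> clinear \<Phi> \<and>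
    \<L> = (\<lambda>X. \<Phi> X + G ** X + X ** G\<dagger>))"

lemma clinear_cp_generator: "cp_generator \<L> \<Longrightarrow> clinear \<L>"
  unfolding cp_generator_def
  by (auto intro!: clinear_add_fun simp: clinear_iff matrix_mult_simps smul_mult_left smul_mult_right smul_add_right)

lemma cp_generator_zero: "cp_generator (\<lambda>X. 0)"
  unfolding cp_generator_def
  by (rule exI[of _ "\<lambda>X. 0"], rule exI[of _ 0])
    (simp add: completely_positive_zero clinear_iff matrix_mult_simps smul_def vec_eq_iff)

lemma cp_generator_add:
  assumes "cp_generator \<L>" "cp_generator \<L>'"
  shows "cp_generator (\<lambda>X. \<L> X + \<L>' X)"
proof -
  obtain \<Phi> G \<Phi>' G' where
    "completely_positive \<Phi>" "clinear \<Phi>" "\<L> = (\<lambda>X. \<Phi> X + G ** X + X ** G\<dagger>)"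
    "completely_positive \<Phi>'" "clinear \<Phi>'" "\<L>' = (\<lambda>X. \<Phi>' X + G' ** X + X ** G'\<dagger>)"
    using assms unfolding cp_generator_def by blast
  then show ?thesis
    unfolding cp_generator_def
    by (intro exI[of _ "\<lambda>X. \<Phi> X + \<Phi>' X"] exI[of _ "G + G'"])
      (simp add: completely_positive_add clinear_add_fun dagger_add matrix_mult_simps add_ac)
qed

lemma cp_generator_sum:
  "(\<And>i. i \<in> I \<Longrightarrow> cp_generator (\<L> i)) \<Longrightarrow> cp_generator (\<lambda>X. \<Sum>i\<in>I. \<L> i X)"
  by (induction I rule: infinite_finite_induct) (simp_all add: cp_generator_zero cp_generator_add)

lemma cp_generator_commutator:
  assumes "hermitian H"
  shows "cp_generator (\<lambda>X. (- \<i>) *\<^sub>C commutator H X)"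
proof -
  \<comment> \<open>Here the completely positive part is 0 and \<open>G\<close> is
    \<open>- \<i>\<close> times \<open>H\<close>; hermiticity turns \<open>X ** G\<dagger>\<close>
    into \<open>\<i>\<close> times \<open>X ** H\<close>.\<close>
  have "(\<lambda>X. (- \<i>) *\<^sub>C commutator H X) = (\<lambda>X. 0 + ((- \<i>) *\<^sub>C H) ** X + X ** ((- \<i>) *\<^sub>C H)\<dagger>)"
    using assms
    by (simp add: fun_eq_iff commutator_def hermitian_def dagger_smul smul_mult_left smul_mult_right)
      (simp add: smul_def vec_eq_iff algebra_simps)
  then show ?thesis
    unfolding cp_generator_def
    by (intro exI[of _ "\<lambda>X. 0"] exI[of _ "(- \<i>) *\<^sub>C H"])
      (simp add: completely_positive_zero clinear_iff smul_def vec_eq_iff)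
qed

lemma cp_generator_dissipator: "cp_generator (dissipator A)"
proof -
  \<comment> \<open>The complex factor one half is made real so that the \<open>scaleR\<close> laws
    of matrix multiplication apply.\<close>
  have half: "(1 / 2) *\<^sub>C X = (1 / 2) *\<^sub>R X" for X :: "'a op"
    using smul_of_real[of "1 / 2" X] by simp
  show ?thesis
    unfolding cp_generator_def
    \<comment> \<open>\<open>G\<close> is minus one half of the self-adjoint
      \<open>A\<dagger> ** A\<close>, so its two products with \<open>X\<close> make up the
      anticommutator.\<close>
    by (intro exI[of _ "\<lambda>X. A ** X ** A\<dagger>"] exI[of _ "(- 1 / 2) *\<^sub>R (A\<dagger> ** A)"])
      (simp add: completely_positive_conjugation clinear_conjugation fun_eq_iff dissipator_def half
        anticommutator_def dagger_minus dagger_scaleR dagger_mult matrix_mult_simps scaleR_add_right)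
qed

lemma cp_generator_lindblad: "hermitian H \<Longrightarrow> cp_generator (lindblad N H L J)"
  unfolding lindblad_def[abs_def]
  by (intro cp_generator_add cp_generator_sum cp_generator_commutator cp_generator_dissipator)

lemma completely_positive_exp_map_cp_generator:
  assumes "cp_generator \<L>" "0 \<le> t"
  shows "completely_positive (exp_map t \<L>)"
proof -
  obtain \<Phi> G where \<Phi>: "completely_positive \<Phi>" "clinear \<Phi>"
    and \<L>: "\<L> = (\<lambda>X. \<Phi> X + G ** X + X ** G\<dagger>)"
    using assms(1) unfolding cp_generator_def by blast
  define K where "K = (\<lambda>X. G ** X ** G\<dagger>)"
  define A where "A \<epsilon> = sqrt \<epsilon> *\<^sub>R G + (1 / sqrt \<epsilon>) *\<^sub>R mat 1" for \<epsilon>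
  define \<Psi> where "\<Psi> \<epsilon> X = \<Phi> X + A \<epsilon> ** X ** (A \<epsilon>)\<dagger>" for \<epsilon> X
  have bl: "bounded_linear \<L>" "bounded_linear K" "\<And>\<epsilon>. bounded_linear (\<Psi> \<epsilon>)"
    using clinear_cp_generator[OF assms(1)] \<Phi>(2) unfolding K_def \<Psi>_def
    by (auto intro!: clinear_imp_bounded_linear clinear_add_fun clinear_conjugation)
  show ?thesis
  proof (rule completely_positive_tendsto)
    \<comment> \<open>The limit is two-sided, but completing the square with
      \<open>sqrt \<epsilon>\<close> takes a positive \<open>\<epsilon>\<close>; hence the
      restriction to the right of 0.\<close>
    show "((\<lambda>\<epsilon>. exp_map t (\<lambda>X. \<L> X + \<epsilon> *\<^sub>R K X) X) \<longlongrightarrow> exp_map t \<L> X) (at_right 0)" for X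
      by (rule tendsto_mono[OF _ exp_map_perturb_tendsto[OF bl(1,2)]]) (simp add: at_le)
    have cp: "completely_positive (exp_map t (\<lambda>X. \<L> X + \<epsilon> *\<^sub>R K X))" if "0 < \<epsilon>" for \<epsilon>
    proof -
      \<comment> \<open>The cross terms of
        \<open>A \<epsilon> ** X ** (A \<epsilon>)\<dagger>\<close> have coefficient 1 and give
        \<open>G ** X + X ** G\<dagger>\<close>; the other two are
        \<open>\<epsilon> *\<^sub>R K X\<close> and \<open>X / \<epsilon>\<close>.\<close>
      have "\<L> X + \<epsilon> *\<^sub>R K X = \<Psi> \<epsilon> X - (1 / \<epsilon>) *\<^sub>R X" for X
        using that
        by (simp add: \<L> K_def \<Psi>_def A_def dagger_add dagger_scaleR matrix_mult_simps scaleR_add_right)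
      then have "exp_map t (\<lambda>X. \<L> X + \<epsilon> *\<^sub>R K X) = (\<lambda>X. exp (- (1 / \<epsilon> * t)) *\<^sub>R exp_map t (\<Psi> \<epsilon>) X)"
        by (simp only: fun_eq_iff exp_map_shift[OF bl(3)] simp_thms)
      moreover have "completely_positive (\<Psi> \<epsilon>)"
        unfolding \<Psi>_def by (intro completely_positive_add \<Phi>(1) completely_positive_conjugation)
      ultimately show ?thesis
        using assms(2) bl(3) by (simp add: completely_positive_scaleR completely_positive_exp_map)
    qed
    show "\<forall>\<^sub>F \<epsilon> in at_right 0. completely_positive (exp_map t (\<lambda>X. \<L> X + \<epsilon> *\<^sub>R K X))"
      by (rule eventually_mono[OF eventually_at_right_less cp])
  qed simp
qed

section \<open>Trace preservation and channels\<close>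

text \<open>Every term of the series after the zeroth lies in the image of \<open>\<L>\<close> and
  is killed by the trace, which is continuous.\<close>

lemma trace_exp_map:
  assumes "bounded_linear \<L>" "\<And>X. trace (\<L> X) = 0"
  shows "trace (exp_map t \<L> X) = trace X"
proof -
  have bl: "bounded_linear (trace :: 'a op \<Rightarrow> complex)"
    unfolding linear_conv_bounded_linear[symmetric]
    by (rule linearI) (simp add: trace_add, simp add: trace_def scaleR_sum_right)
  have "trace ((t ^ n / fact n) *\<^sub>R (\<L> ^^ n) X) = 0" if "n \<noteq> 0" for n
    using that assms(2) by (cases n) (simp_all add: linear_cmul[OF bounded_linear.linear[OF bl]])
  then have "(\<lambda>n. trace ((t ^ n / fact n) *\<^sub>R (\<L> ^^ n) X)) sums trace X"
    using sums_finite[of "{0}" "\<lambda>n. trace ((t ^ n / fact n) *\<^sub>R (\<L> ^^ n) X)"] by simp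
  moreover have "(\<lambda>n. trace ((t ^ n / fact n) *\<^sub>R (\<L> ^^ n) X)) sums trace (exp_map t \<L> X)"
    using bounded_linear.sums[OF bl exp_map_sums[OF assms(1)]]
    by (simp add: exp_map_eq_exp[OF assms(1)])
  ultimately show ?thesis
    by (rule sums_unique2[symmetric])
qed

text \<open>By cyclicity all three terms are multiples of the trace of
  \<open>A\<dagger> ** A ** X\<close>, with weights 1, -1/2 and -1/2.\<close>

lemma trace_dissipator: "trace (dissipator A X) = 0"
proof -
  have "trace (A ** X ** A\<dagger>) = trace (A\<dagger> ** A ** X)" "trace (X ** (A\<dagger> ** A)) = trace (A\<dagger> ** A ** X)"
    by (metis matrix_mul_assoc trace_mul_sym)+
  moreover have "trace (c *\<^sub>C Y) = c * trace Y" for c and Y :: "'a op"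
    by (simp add: trace_def smul_def sum_distrib_left)
  ultimately show ?thesis
    by (simp add: dissipator_def anticommutator_def trace_sub trace_add)
qed

lemma trace_sum: "trace (\<Sum>i\<in>I. X i :: ('m::finite) op) = (\<Sum>i\<in>I. trace (X i))"
  by (induction I rule: infinite_finite_induct) (simp_all add: trace_add, simp_all add: trace_def)

lemma trace_lindblad: "trace (lindblad N H L J X) = 0"
proof -
  have "trace (c *\<^sub>C commutator H X) = 0" for c
    using trace_mul_sym[of H X]
    by (simp add: commutator_def trace_def smul_def sum_subtractf flip: sum_distrib_left)
  then show ?thesis
    by (simp add: lindblad_def trace_add trace_sum trace_dissipator)
qed

text \<open>Multiplication by a complex scalar is a bounded real linear map commuting with
  \<open>\<L>\<close>, so complex homogeneity is an instance of intertwining.\<close>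

lemma clinear_exp_map:
  assumes "clinear \<L>"
  shows "clinear (exp_map t \<L>)"
proof -
  have bl: "bounded_linear \<L>"
    by (rule clinear_imp_bounded_linear[OF assms])
  have "clinear ((*\<^sub>C) c :: 'a op \<Rightarrow> 'a op)" for c
    by (simp add: clinear_iff smul_add_right) (simp add: smul_def vec_eq_iff)
  then have "c *\<^sub>C exp_map t \<L> X = exp_map t \<L> (c *\<^sub>C X)" for c X
    using assms by (intro exp_map_intertwine bl clinear_imp_bounded_linear) (simp_all add: clinear_iff)
  then show ?thesis
    using linear_add[OF bounded_linear.linear[OF bounded_linear_exp_map[OF bl]]]
    by (simp add: clinear_iff)
qed

lemma channel_exp_map:
  assumes "cp_generator \<L>" "\<And>X. trace (\<L> X) = 0" "0 \<le> t"
  shows "channel (exp_map t \<L>)"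
  using clinear_cp_generator[OF assms(1)] assms
  by (simp add: channel_def clinear_exp_map completely_positive_exp_map_cp_generator trace_exp_map
      clinear_imp_bounded_linear)


section \<open>Density operators span all operators\<close>

lemma dissipator_add: "dissipator A (X + Y) = dissipator A X + dissipator A Y"
  using clinear_cp_generator[OF cp_generator_dissipator[of A]] by (simp add: clinear_iff)

definition outer :: "complex^'m \<Rightarrow> complex^'m \<Rightarrow> ('m::finite) op"
  where "outer v w = (\<chi> i j. v $ i * cnj (w $ j))"

lemma density_op_outer:
  assumes "v \<noteq> 0"
  shows "density_op ((1 / (norm v)\<^sup>2) *\<^sub>R outer v v)"
  unfolding density_op_def positive_op_def
proof (intro conjI allI)
  fix u
  \<comment> \<open>\<open>z\<close> is the inner product of \<open>v\<close> with \<open>u\<close>;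
    the quadratic form is its squared modulus over the squared norm of \<open>v\<close>.\<close>
  define z where "z = (\<Sum>i\<in>UNIV. cnj (v $ i) * u $ i)"
  have "((1 / (norm v)\<^sup>2) *\<^sub>R outer v v *v u) $ i = (1 / (norm v)\<^sup>2) *\<^sub>R (v $ i * z)" for i
    by (simp add: matrix_vector_mult_def outer_def z_def sum_distrib_left mult_ac scaleR_sum_right)
  then have "cinner u ((1 / (norm v)\<^sup>2) *\<^sub>R outer v v *v u) =
      (1 / (norm v)\<^sup>2) *\<^sub>R ((\<Sum>i\<in>UNIV. cnj (u $ i) * v $ i) * z)"
    by (simp add: cinner_def sum_distrib_left scaleR_sum_right mult_ac)
  also have "(\<Sum>i\<in>UNIV. cnj (u $ i) * v $ i) = cnj z"
    by (simp add: z_def mult.commute)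
  also have "(1 / (norm v)\<^sup>2) *\<^sub>R (cnj z * z) = of_real ((1 / (norm v)\<^sup>2) * (cmod z)\<^sup>2)"
    by (simp add: scaleR_conv_of_real mult.commute complex_mult_cnj cmod_power2)
  finally show "cinner u ((1 / (norm v)\<^sup>2) *\<^sub>R outer v v *v u) \<in> \<real>\<^sub>\<ge>\<^sub>0"
    by simp
next
  have "(norm v)\<^sup>2 = (\<Sum>i\<in>UNIV. (cmod (v $ i))\<^sup>2)"
    by (simp add: norm_vec_def L2_set_def sum_nonneg)
  moreover have "trace (outer v v) = of_real (\<Sum>i\<in>UNIV. (cmod (v $ i))\<^sup>2)"
    by (simp add: trace_def outer_def complex_norm_square[symmetric] del: of_real_power)
  ultimately have "trace (outer v v) = of_real ((norm v)\<^sup>2)"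
    by simp
  moreover have "trace ((1 / (norm v)\<^sup>2) *\<^sub>R outer v v) = (1 / (norm v)\<^sup>2) *\<^sub>R trace (outer v v)"
    by (simp add: trace_def scaleR_sum_right)
  ultimately show "trace ((1 / (norm v)\<^sup>2) *\<^sub>R outer v v) = 1"
    using assms by (simp add: scaleR_conv_of_real)
qed

text \<open>For nonzero \<open>v\<close>, \<open>outer v v\<close> is a positive multiple of a
  density operator; polarization reaches every \<open>outer v w\<close>, and these include the
  matrix units. The main proof uses this to pass from the vanishing of \<open>tick_generator\<close>
  on states to its vanishing everywhere.\<close>

lemma clinear_zero_if_zero_on_density_op:
  fixes F :: "('m::finite) op \<Rightarrow> complex^'p^'q"
  assumes F: "clinear F" and density: "\<And>\<rho>. density_op \<rho> \<Longrightarrow> F \<rho> = 0"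
  shows "F X = 0"
proof -
  have add: "F (X + Y) = F X + F Y" and smul: "F (c *\<^sub>C X) = c *\<^sub>C F X" for X Y c
    using F by (simp_all add: clinear_iff)
  have zero: "F 0 = 0"
    using add[of 0 0] by simp
  have diag: "F (outer v v) = 0" for v
  proof (cases "v = 0")
    case True
    then have "outer v v = 0" by (simp add: outer_def vec_eq_iff)
    with zero show ?thesis by simp
  next
    case False
    have "F (outer v v) = F (((norm v)\<^sup>2) *\<^sub>R ((1 / (norm v)\<^sup>2) *\<^sub>R outer v v))"
      using False by simp
    also have "\<dots> = (norm v)\<^sup>2 *\<^sub>R F ((1 / (norm v)\<^sup>2) *\<^sub>R outer v v)"
      by (simp only: smul flip: smul_of_real)
    finally show ?thesis
      by (simp add: density[OF density_op_outer[OF False]])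
  qed
  \<comment> \<open>polarization: expand \<open>F\<close> on the projections along \<open>v + w\<close> and \<open>v + \<i> w\<close>\<close>
  have "F (outer v w) = 0" for v w
  proof -
    have "outer (v + w) (v + w) = outer v v + outer w w + (outer v w + outer w v)"
      by (simp add: outer_def vec_eq_iff algebra_simps)
    then have 1: "F (outer v w) + F (outer w v) = 0"
      using diag[of v] diag[of w] diag[of "v + w"] by (simp add: add)
    define w' where "w' = (\<chi> i. \<i> * w $ i)"
    have "outer (v + w') (v + w') =
        outer v v + outer w' w' + ((- \<i>) *\<^sub>C outer v w + \<i> *\<^sub>C outer w v)"
      by (simp add: outer_def w'_def smul_def vec_eq_iff algebra_simps)
    then have 2: "(- \<i>) *\<^sub>C F (outer v w) + \<i> *\<^sub>C F (outer w v) = 0"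
      using diag[of v] diag[of w'] diag[of "v + w'"] by (simp add: add smul)
    show ?thesis
    proof (simp add: vec_eq_iff, intro allI)
      fix i j
      \<comment> \<open>The two relations make the entries of \<open>F (outer v w)\<close> and
        \<open>F (outer w v)\<close> both opposite and equal.\<close>
      have "F (outer v w) $ i $ j + F (outer w v) $ i $ j = 0"
        using 1 by (simp add: vec_eq_iff)
      moreover have "- \<i> * F (outer v w) $ i $ j + \<i> * F (outer w v) $ i $ j = 0"
        using 2 by (simp add: smul_def vec_eq_iff)
      ultimately show "F (outer v w) $ i $ j = 0"
        by (simp add: add_eq_0_iff flip: minus_mult_right)
    qed
  qed
  moreover have "X = (\<Sum>i\<in>UNIV. \<Sum>j\<in>UNIV. X $ i $ j *\<^sub>C outer (axis i 1) (axis j 1))"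
  proof -
    have "X $ i $ j * (axis i 1 $ a * cnj (axis j 1 $ b)) =
        (if j = b then if i = a then X $ i $ j else 0 else 0)" for i j a b
      by (auto simp: axis_def)
    then show ?thesis
      by (simp add: vec_eq_iff smul_def outer_def)
  qed
  moreover have "F (\<Sum>i\<in>I. Y i) = (\<Sum>i\<in>I. F (Y i))" for I :: "'m set" and Y
    by (induction I rule: infinite_finite_induct) (simp_all add: zero add)
  moreover have "c *\<^sub>C (0 :: complex^'p^'q) = 0" for c
    by (simp add: smul_def vec_eq_iff)
  ultimately show ?thesis
    by (metis (no_types, lifting) smul sum.neutral)
qed

section \<open>The register and partial traces\<close>

lemma Rep_reg_eq_iff_Abs:
  fixes i :: "('n::finite) reg"
  assumes "m \<le> CARD('n)"
  shows "Rep_reg i = m \<longleftrightarrow> i = Abs_reg m"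
  using assms by (metis Abs_reg_inverse Rep_reg_inverse atLeastAtMost_iff zero_le)

lemma Rep_reg_le: "Rep_reg (i :: ('n::finite) reg) \<le> CARD('n)"
  using Rep_reg[of i] by simp

text \<open>The Kronecker delta sits on the representing number, so that register labels are
  compared by arithmetic on naturals.\<close>

lemma sum_reg_of_bool:
  fixes f :: "('n::finite) reg \<Rightarrow> 'b::comm_semiring_1"
  assumes "m \<le> CARD('n)"
  shows "(\<Sum>i\<in>UNIV. of_bool (Rep_reg i = m) * f i) = f (Abs_reg m)"
proof -
  have "(\<Sum>i\<in>UNIV. of_bool (Rep_reg i = m) * f i) = (\<Sum>i\<in>UNIV. if i = Abs_reg m then f i else 0)"
    by (intro sum.cong) (simp_all add: Rep_reg_eq_iff_Abs[OF assms])
  then show ?thesis by simp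
qed

lemma ket_nth:
  fixes i :: "('n::finite) reg"
  shows "ket n $ i = of_bool (int (Rep_reg i) = n mod (int CARD('n) + 1))"
proof -
  define m where "m = nat (n mod (int CARD('n) + 1))"
  have "m \<le> CARD('n)" and "int m = n mod (int CARD('n) + 1)"
    using pos_mod_bound[of "int CARD('n) + 1" n] pos_mod_sign[of "int CARD('n) + 1" n]
    by (simp_all add: m_def)
  then show ?thesis
    using Rep_reg_eq_iff_Abs[of m i] by (auto simp: ket_def axis_def m_def)
qed

text \<open>Labels up to \<open>CARD('n)\<close> are fixed by the reduction modulo
  \<open>CARD('n) + 1\<close> that is built into \<open>ket\<close>.\<close>

lemma ketbra_nth:
  fixes i j :: "('n::finite) reg"
  assumes "a \<le> CARD('n)" "b \<le> CARD('n)"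
  shows "ketbra (int a) (int b) $ i $ j = of_bool (Rep_reg i = a) * of_bool (Rep_reg j = b)"
  using assms by (simp add: ketbra_def ket_nth)

lemma ketbra_mult:
  assumes "b \<le> CARD('n)" "c \<le> CARD('n)" "a \<le> CARD('n)" "d \<le> CARD('n)"
  shows "(ketbra (int a) (int b) :: ('n::finite) reg op) ** ketbra (int c) (int d) =
    (if b = c then ketbra (int a) (int d) else 0)"
proof -
  have "(\<Sum>k\<in>(UNIV :: 'n reg set). of_bool (Rep_reg i = a) * of_bool (Rep_reg k = b) *
      (of_bool (Rep_reg k = c) * of_bool (Rep_reg j = d))) =
      of_bool (Rep_reg i = a) * (of_bool (b = c) * (of_bool (Rep_reg j = d) :: complex))" for i j :: "'n reg"
  proof -
    have "(\<Sum>k\<in>(UNIV :: 'n reg set). of_bool (Rep_reg i = a) * of_bool (Rep_reg k = b) *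
        (of_bool (Rep_reg k = c) * of_bool (Rep_reg j = d))) =
        (\<Sum>k\<in>(UNIV :: 'n reg set). of_bool (Rep_reg k = b) * (of_bool (Rep_reg i = a) *
          (of_bool (Rep_reg k = c) * (of_bool (Rep_reg j = d) :: complex))))"
      by (intro sum.cong refl) (simp only: mult_ac)
    also have "\<dots> = of_bool (Rep_reg i = a) *
        (of_bool (Rep_reg (Abs_reg b :: 'n reg) = c) * of_bool (Rep_reg j = d))"
      by (rule sum_reg_of_bool[OF assms(1)])
    finally show ?thesis
      using assms(1) by (simp add: Abs_reg_inverse)
  qed
  then show ?thesis
    using assms by (simp add: matrix_matrix_mult_def vec_eq_iff ketbra_nth)
qed

lemma dagger_ketbra: "(ketbra m n)\<dagger> = ketbra n m"
  by (simp add: dagger_def ketbra_def vec_eq_iff mult.commute)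

lemma trace_ketbra: "k \<le> CARD('n) \<Longrightarrow> trace (ketbra (int k) (int k) :: ('n::finite) reg op) = 1"
  using sum_reg_of_bool[of k "\<lambda>i :: 'n reg. of_bool (Rep_reg i = k) :: complex"]
  by (simp add: trace_def ketbra_nth Abs_reg_inverse)

lemma advance_nth:
  fixes i j :: "('n::finite) reg"
  shows "advance l $ i $ j =
    (if Rep_reg j < CARD('n) then of_bool (Rep_reg i = Rep_reg j + 1) else l * of_bool (Rep_reg i = 0))"
proof -
  \<comment> \<open>The upper summation bound is a truncated difference; positivity of
    \<open>CARD('n)\<close> makes it mean \<open>n < CARD('n)\<close>.\<close>
  have le: "n \<le> CARD('n) - Suc 0 \<longleftrightarrow> n < CARD('n)" for n
    using zero_less_card_finite[where 'a = 'n] by arith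
  have "(\<Sum>n=0..CARD('n) - 1. ketbra (int n + 1) (int n) $ i $ j) =
      (\<Sum>n=0..CARD('n) - 1. of_bool (Rep_reg i = n + 1) * (of_bool (Rep_reg j = n) :: complex))"
  proof (intro sum.cong refl)
    fix n
    assume "n \<in> {0..CARD('n) - 1}"
    then have "n + 1 \<le> CARD('n)"
      by (simp add: le)
    then show "ketbra (int n + 1) (int n) $ i $ j =
        of_bool (Rep_reg i = n + 1) * (of_bool (Rep_reg j = n) :: complex)"
      using ketbra_nth[of "n + 1" n i j] by (simp add: add.commute)
  qed
  also have "\<dots> = (\<Sum>n=0..CARD('n) - 1. if n = Rep_reg j then of_bool (Rep_reg i = Rep_reg j + 1) else 0)"
    by (intro sum.cong) auto
  also have "\<dots> = of_bool (Rep_reg j < CARD('n) \<and> Rep_reg i = Rep_reg j + 1)"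
    by (auto simp: le)
  finally have "(\<Sum>n=0..CARD('n) - 1. ketbra (int n + 1) (int n) $ i $ j) =
    (of_bool (Rep_reg j < CARD('n) \<and> Rep_reg i = Rep_reg j + 1) :: complex)" .
  moreover have "ketbra 0 (int CARD('n)) $ i $ j =
      of_bool (Rep_reg i = 0) * (of_bool (Rep_reg j = CARD('n)) :: complex)"
    using ketbra_nth[of 0 "CARD('n)" i j] by simp
  ultimately show ?thesis
    using Rep_reg_le[of j] by (auto simp: advance_def smul_def sum_component)
qed

text \<open>The columns of \<open>advance l\<close> are distinct basis vectors, the last one scaled
  by \<open>l\<close>. Their Gram matrix is the identity with last diagonal entry replaced by
  \<open>cnj l * l\<close>: for \<open>l = 1\<close> the operator is unitary, for
  \<open>l = 0\<close> exactly the last tick is lost.\<close>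

lemma dagger_advance_mult_advance:
  "(advance l)\<dagger> ** advance l =
    mat 1 + (cnj l * l - 1) *\<^sub>C (ketbra (int CARD('n)) (int CARD('n)) :: ('n::finite) reg op)"
  (is "?A = ?B")
proof (simp only: vec_eq_iff, intro allI)
  fix j k :: "'n reg"
  have inj: "j = k \<longleftrightarrow> Rep_reg j = Rep_reg k"
    by (simp add: Rep_reg_inject)
  have le: "Rep_reg j \<le> CARD('n)" "Rep_reg k \<le> CARD('n)"
    by (rule Rep_reg_le)+
  have nth: "?A $ j $ k = (\<Sum>i\<in>UNIV. cnj (advance l $ i $ j) * advance l $ i $ k)"
    by (simp add: matrix_matrix_mult_def dagger_def)
  show "?A $ j $ k = ?B $ j $ k"
  proof (cases "Rep_reg j < CARD('n)")
    case True
    have "?A $ j $ k = (\<Sum>i\<in>UNIV. of_bool (Rep_reg i = Rep_reg j + 1) * (advance l $ i $ k))"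
      using True unfolding nth by (intro sum.cong refl) (simp add: advance_nth[of _ _ j])
    also have "\<dots> = advance l $ Abs_reg (Rep_reg j + 1) $ k"
      using True by (intro sum_reg_of_bool) simp
    finally show ?thesis
      using True le
      by (auto simp: advance_nth Abs_reg_inverse smul_def ketbra_nth mat_def inj)
  next
    case False
    have "?A $ j $ k = (\<Sum>i\<in>UNIV. of_bool (Rep_reg i = 0) * (cnj l * advance l $ i $ k))"
      using False unfolding nth by (intro sum.cong refl) (simp add: advance_nth[of _ _ j])
    also have "\<dots> = cnj l * advance l $ Abs_reg 0 $ k"
      by (intro sum_reg_of_bool) simp
    finally show ?thesis
      using False le
      by (auto simp: advance_nth Abs_reg_inverse smul_def ketbra_nth mat_def inj)
  qed
qed

section \<open>Tensor products and partial traces\<close>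

lemma sum_UNIV_prod: "(\<Sum>p\<in>UNIV. f p) = (\<Sum>a\<in>UNIV. \<Sum>b\<in>UNIV. f (a, b))"
  for f :: "'x::finite \<times> 'y::finite \<Rightarrow> 'z::comm_monoid_add"
  by (simp add: sum.cartesian_product)

lemma tensor_mult: "(A \<otimes> B) ** (C \<otimes> D) = (A ** C) \<otimes> (B ** D)"
  by (simp add: tensor_def matrix_matrix_mult_def vec_eq_iff sum_UNIV_prod sum_product mult_ac)

lemma dagger_tensor: "(A \<otimes> B)\<dagger> = A\<dagger> \<otimes> B\<dagger>"
  by (simp add: dagger_def tensor_def vec_eq_iff)

lemma tensor_mat_1: "mat 1 \<otimes> mat 1 = mat 1"
  by (auto simp: tensor_def mat_def vec_eq_iff prod_eq_iff)

lemma tensor_add_right: "A \<otimes> (B + C) = A \<otimes> B + A \<otimes> C"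
  by (simp add: tensor_def vec_eq_iff distrib_left)

lemma tensor_diff_left: "(A - B) \<otimes> C = A \<otimes> C - B \<otimes> C"
  by (simp add: tensor_def vec_eq_iff left_diff_distrib)

lemma tensor_add_left: "(A + B) \<otimes> C = A \<otimes> C + B \<otimes> C"
  by (simp add: tensor_def vec_eq_iff distrib_right)

lemma tensor_sum_left: "(\<Sum>i\<in>I. A i) \<otimes> B = (\<Sum>i\<in>I. A i \<otimes> B)"
  by (induction I rule: infinite_finite_induct)
    (simp_all add: tensor_add_left, simp_all add: tensor_def vec_eq_iff)

lemma tensor_smul_left: "(c *\<^sub>C A) \<otimes> B = c *\<^sub>C (A \<otimes> B)"
  by (simp add: tensor_def smul_def vec_eq_iff mult.assoc)

lemma tensor_zero_right [simp]: "A \<otimes> 0 = 0"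
  by (simp add: tensor_def vec_eq_iff)

lemma tr_R_add: "tr_R (X + Y) = tr_R X + tr_R Y"
  by (simp add: tr_R_def vec_eq_iff sum.distrib)

lemma tr_R_diff: "tr_R (X - Y) = tr_R X - tr_R Y"
  by (simp add: tr_R_def vec_eq_iff sum_subtractf)

lemma tr_R_smul: "tr_R (c *\<^sub>C X) = c *\<^sub>C tr_R X"
  by (simp add: tr_R_def smul_def vec_eq_iff sum_distrib_left)

lemma tr_R_sum: "tr_R (\<Sum>i\<in>I. X i) = (\<Sum>i\<in>I. tr_R (X i))"
  by (induction I rule: infinite_finite_induct) (simp_all add: tr_R_add, simp_all add: tr_R_def vec_eq_iff)

lemma bounded_linear_tr_R: "bounded_linear (tr_R :: ('c::finite, 'n::finite) joint_op \<Rightarrow> 'c op)"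
  unfolding linear_conv_bounded_linear[symmetric]
  by (rule linearI) (simp add: tr_R_add, simp add: tr_R_smul flip: smul_of_real)

lemma bounded_linear_tr_C: "bounded_linear (tr_C :: ('c::finite, 'n::finite) joint_op \<Rightarrow> 'n reg op)"
  unfolding linear_conv_bounded_linear[symmetric]
  by (rule linearI) (simp_all add: tr_C_def vec_eq_iff sum.distrib scaleR_sum_right)

lemma tr_R_tensor: "tr_R (A \<otimes> B) = trace B *\<^sub>C A"
  by (simp add: tr_R_def tensor_def smul_def trace_def vec_eq_iff sum_distrib_left mult_ac)

lemma tr_C_tensor: "tr_C (A \<otimes> B) = trace A *\<^sub>C B"
  by (simp add: tr_C_def tensor_def smul_def trace_def vec_eq_iff sum_distrib_right)

lemma tr_R_mult_left: "tr_R ((A \<otimes> mat 1) ** X) = A ** tr_R X"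
proof -
  have "(\<Sum>r\<in>UNIV. \<Sum>a\<in>UNIV. \<Sum>b\<in>UNIV. A $ i $ a * mat 1 $ r $ b * X $ (a, b) $ (j, r)) =
      (\<Sum>a\<in>UNIV. \<Sum>r\<in>UNIV. A $ i $ a * X $ (a, r) $ (j, r))" for i j
    by (subst sum.swap) (simp add: mat_def if_distrib if_distribR cong: if_cong)
  then show ?thesis
    by (simp add: tr_R_def tensor_def matrix_matrix_mult_def vec_eq_iff sum_UNIV_prod sum_distrib_left)
qed

lemma tr_R_mult_right: "tr_R (X ** (A \<otimes> mat 1)) = tr_R X ** A"
proof -
  have "(\<Sum>r\<in>UNIV. \<Sum>a\<in>UNIV. \<Sum>b\<in>UNIV. X $ (i, r) $ (a, b) * (A $ a $ j * mat 1 $ b $ r)) =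
      (\<Sum>a\<in>UNIV. \<Sum>r\<in>UNIV. X $ (i, r) $ (a, r) * A $ a $ j)" for i j
    by (subst sum.swap) (simp add: mat_def if_distrib if_distribR cong: if_cong)
  then show ?thesis
    by (simp add: tr_R_def tensor_def matrix_matrix_mult_def vec_eq_iff sum_UNIV_prod sum_distrib_right)
qed

text \<open>\<open>B\<close> acts on the factor that is traced out, so the cyclicity of the trace of
  that factor applies.\<close>

lemma tr_R_cyclic: "tr_R (X ** (mat 1 \<otimes> B)) = tr_R ((mat 1 \<otimes> B) ** X)"
proof -
  have "(\<Sum>r\<in>UNIV. \<Sum>a\<in>UNIV. \<Sum>b\<in>UNIV. X $ (i, r) $ (a, b) * (mat 1 $ a $ j * B $ b $ r)) =
      (\<Sum>r\<in>UNIV. \<Sum>b\<in>UNIV. X $ (i, r) $ (j, b) * B $ b $ r)" for i j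
    by (subst sum.swap[where A = "UNIV :: 'a set"]) (simp add: mat_def if_distrib if_distribR cong: if_cong)
  moreover have "(\<Sum>r\<in>UNIV. \<Sum>a\<in>UNIV. \<Sum>b\<in>UNIV. mat 1 $ i $ a * B $ r $ b * X $ (a, b) $ (j, r)) =
      (\<Sum>r\<in>UNIV. \<Sum>b\<in>UNIV. B $ r $ b * X $ (i, b) $ (j, r))" for i j
    by (subst sum.swap[where A = "UNIV :: 'a set"]) (simp add: mat_def if_distrib if_distribR cong: if_cong)
  moreover have "(\<Sum>r\<in>UNIV. \<Sum>b\<in>UNIV. X $ (i, r) $ (j, b) * B $ b $ r) =
      (\<Sum>r\<in>UNIV. \<Sum>b\<in>UNIV. B $ r $ b * X $ (i, b) $ (j, r))" for i j
    by (subst sum.swap) (simp add: mult.commute)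
  ultimately show ?thesis
    by (simp add: tr_R_def tensor_def matrix_matrix_mult_def vec_eq_iff sum_UNIV_prod)
qed

text \<open>The register factor \<open>B\<dagger>\<close> is cycled round to meet \<open>B\<close>,
  while the clockwork factors leave the partial trace on their own sides. All three terms then
  contain \<open>Y\<close> through one and the same partial trace.\<close>

lemma tr_R_dissipator:
  "tr_R (dissipator (A \<otimes> B) Y) = dissipator A (tr_R ((mat 1 \<otimes> (B\<dagger> ** B)) ** Y))"
proof -
  \<comment> \<open>Clockwork and register factors commute; each time the order is chosen that puts
    the clockwork factor outermost.\<close>
  have split: "C \<otimes> D = (C \<otimes> mat 1) ** (mat 1 \<otimes> D)" "C \<otimes> D = (mat 1 \<otimes> D) ** (C \<otimes> mat 1)" for C D
    by (simp_all add: tensor_mult)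
  let ?Q = "mat 1 \<otimes> (B\<dagger> ** B)"
  have "tr_R ((A \<otimes> B) ** Y ** (A\<dagger> \<otimes> B\<dagger>)) =
      tr_R ((A \<otimes> mat 1) ** ((mat 1 \<otimes> B) ** Y ** (mat 1 \<otimes> B\<dagger>)) ** (A\<dagger> \<otimes> mat 1))"
    by (subst split(1)[of A B], subst split(2)[of "A\<dagger>" "B\<dagger>"]) (simp add: matrix_mul_assoc)
  also have "\<dots> = A ** tr_R ((mat 1 \<otimes> B\<dagger>) ** ((mat 1 \<otimes> B) ** Y)) ** A\<dagger>"
    by (simp only: tr_R_mult_left tr_R_mult_right tr_R_cyclic)
  also have "\<dots> = A ** tr_R (?Q ** Y) ** A\<dagger>"
    by (simp add: matrix_mul_assoc tensor_mult)
  finally have jump: "tr_R ((A \<otimes> B) ** Y ** (A\<dagger> \<otimes> B\<dagger>)) = A ** tr_R (?Q ** Y) ** A\<dagger>" .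
  have left: "tr_R (((A\<dagger> ** A) \<otimes> (B\<dagger> ** B)) ** Y) = A\<dagger> ** A ** tr_R (?Q ** Y)"
    by (subst split(1)) (simp add: tr_R_mult_left flip: matrix_mul_assoc)
  have "tr_R (Y ** ((A\<dagger> ** A) \<otimes> (B\<dagger> ** B))) = tr_R (Y ** ?Q) ** (A\<dagger> ** A)"
    by (subst split(2)) (simp only: matrix_mul_assoc tr_R_mult_right)
  then have right: "tr_R (Y ** ((A\<dagger> ** A) \<otimes> (B\<dagger> ** B))) = tr_R (?Q ** Y) ** (A\<dagger> ** A)"
    by (simp add: tr_R_cyclic)
  show ?thesis
    by (simp add: dissipator_def anticommutator_def dagger_tensor tensor_mult
        tr_R_diff tr_R_add tr_R_smul jump left right)
qed

text \<open>With a register projection \<open>Q\<close>, the jump \<open>A \<otimes> Q\<close> is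
  conditioned on the register: it acts as \<open>A\<close> alone when \<open>Q\<close> absorbs
  \<open>K\<close>, and by the next lemma not at all when \<open>Q\<close> and \<open>K\<close> are
  orthogonal.\<close>

lemma dissipator_tensor:
  assumes "Q\<dagger> = Q" "Q ** Q = Q" "Q ** K = K" "K ** Q = K"
  shows "dissipator (A \<otimes> Q) (X \<otimes> K) = dissipator A X \<otimes> K"
  using assms
  by (simp add: dissipator_def anticommutator_def dagger_tensor tensor_mult
      tensor_diff_left tensor_add_left tensor_smul_left)

lemma dissipator_tensor_eq_0:
  assumes "Q\<dagger> = Q" "Q ** K = 0" "K ** Q = 0"
  shows "dissipator (A \<otimes> Q) (X \<otimes> K) = 0"
proof -
  have "Q ** K ** Q = 0" "Q ** Q ** K = 0" "K ** (Q ** Q) = 0"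
    using assms by (simp_all add: matrix_mult_simps matrix_mul_assoc)
      (simp add: assms matrix_mult_simps flip: matrix_mul_assoc)
  then show ?thesis
    by (simp add: assms dissipator_def anticommutator_def dagger_tensor tensor_mult)
      (simp add: smul_def vec_eq_iff)
qed

text \<open>\<open>H \<otimes> mat 1\<close> and \<open>L j \<otimes> mat 1\<close> are blind to the
  register, which enters only as a weight on the ticking jumps.\<close>

lemma tr_R_clock_generator:
  "tr_R (clock_generator l N H L J Y) = (- \<i>) *\<^sub>C commutator H (tr_R Y)
    + (\<Sum>j=1..N. dissipator (L j) (tr_R Y))
    + (\<Sum>j=1..N. dissipator (J j) (tr_R ((mat 1 \<otimes> ((advance l)\<dagger> ** advance l)) ** Y)))"
  by (simp add: clock_generator_def lindblad_def tr_R_add tr_R_smul tr_R_sum tr_R_dissipator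
      commutator_def tr_R_diff tr_R_mult_left tr_R_mult_right tensor_mat_1)


section \<open>Clocks\<close>

lemma exp_map_diff_has_vector_derivative:
  assumes "bounded_linear \<L>" "bounded_linear \<L>'" "bounded_linear T"
  shows "((\<lambda>t. T (exp_map t \<L> X - exp_map t \<L>' X)) has_vector_derivative T (\<L> X - \<L>' X)) (at 0)"
  by (intro bounded_linear.has_vector_derivative[OF assms(3)] has_vector_derivative_diff
      exp_map_has_vector_derivative assms)

text \<open>The difference vanishes at \<open>t = 0\<close> together with its derivative. The map
  \<open>T\<close> lets one argument serve both cut-off conditions, with the identity for the first
  and \<open>tr_C\<close> for the second.\<close>

lemma exp_map_diff_smallo:
  assumes "bounded_linear \<L>" "bounded_linear \<L>'" "bounded_linear T"
    and eq: "T (\<L> X - \<L>' X) = 0"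
  shows "(\<lambda>t. norm (T (exp_map t \<L> X - exp_map t \<L>' X))) \<in> o[at_right 0](\<lambda>t. t)"
proof (rule smalloI_tendsto)
  let ?f = "\<lambda>t. T (exp_map t \<L> X - exp_map t \<L>' X)"
  have "?f 0 = 0"
    using linear_0[OF bounded_linear.linear[OF assms(3)]] by (simp add: exp_map_0 assms)
  then have "((\<lambda>t. norm (?f t) / norm t) \<longlongrightarrow> 0) (at 0)"
    using exp_map_diff_has_vector_derivative[OF assms(1-3), of X] eq
    by (simp add: has_vector_derivative_def has_derivative_at)
  then have "((\<lambda>t. norm (?f t) / norm t) \<longlongrightarrow> 0) (at_right 0)"
    by (rule tendsto_mono[rotated]) (simp add: at_le)
  then show "((\<lambda>t. norm (?f t) / t) \<longlongrightarrow> 0) (at_right 0)"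
    by (rule Lim_transform_eventually)
      (rule eventually_mono[OF eventually_at_right_less], simp)
  show "\<forall>\<^sub>F t in at_right 0. t \<noteq> (0 :: real)"
    by (rule eventually_mono[OF eventually_at_right_less]) simp
qed

lemma smallo_norm_diff_trans:
  fixes f g h :: "'a \<Rightarrow> 'b::real_normed_vector"
  assumes "(\<lambda>x. norm (f x - g x)) \<in> o[F](e)" "(\<lambda>x. norm (g x - h x)) \<in> o[F](e :: 'a \<Rightarrow> real)"
  shows "(\<lambda>x. norm (f x - h x)) \<in> o[F](e)"
proof (rule landau_o.big_small_trans)
  have "norm (f x - h x) \<le> norm (f x - g x) + norm (g x - h x)" for x
    using norm_triangle_ineq[of "f x - g x" "g x - h x"] by simp
  then show "(\<lambda>x. norm (f x - h x)) \<in> O[F](\<lambda>x. norm (f x - g x) + norm (g x - h x))"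
    by (intro bigoI[where c = 1] always_eventually allI) simp
  show "(\<lambda>x. norm (f x - g x) + norm (g x - h x)) \<in> o[F](e)"
    using assms by (rule sum_in_smallo)
qed

text \<open>The cut-off condition sees an evolution only up to \<open>o(t)\<close>, so by the
  triangle inequality it passes between evolutions that agree to that order.\<close>

lemma underlying_periodic_if_smallo:
  fixes M M' P :: "('c::finite, 'n::finite) evolution"
  assumes "underlying_periodic M P"
    and "\<And>\<rho> k. density_op \<rho> \<Longrightarrow> k < CARD('n) \<Longrightarrow>
      (\<lambda>t. norm (from_tick M' k t \<rho> - from_tick M k t \<rho>)) \<in> o[at_right 0](\<lambda>t. t)"
    and "\<And>\<rho>. density_op \<rho> \<Longrightarrow>
      (\<lambda>t. norm (tr_C (from_tick M' CARD('n) t \<rho>) - tr_C (from_tick M CARD('n) t \<rho>)))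
        \<in> o[at_right 0](\<lambda>t. t)"
  shows "underlying_periodic M' P"
  unfolding underlying_periodic_def
proof (intro conjI allI impI)
  show "periodic_evolution P"
    using assms(1) by (simp add: underlying_periodic_def)
  fix \<rho> :: "'c op"
  assume \<rho>: "density_op \<rho>"
  show "(\<lambda>t. norm (from_tick M' k t \<rho> - from_tick P k t \<rho>)) \<in> o[at_right 0](\<lambda>t. t)"
    if "k < CARD('n)" for k
    using assms(1) \<rho> that
    by (intro smallo_norm_diff_trans[OF assms(2)]) (simp_all add: underlying_periodic_def)
  show "(\<lambda>t. norm (tr_C (from_tick M' CARD('n) t \<rho>) - ketbra (int CARD('n)) (int CARD('n))))
      \<in> o[at_right 0](\<lambda>t. t)"
    using assms(1) \<rho>
    by (intro smallo_norm_diff_trans[OF assms(3)]) (simp_all add: underlying_periodic_def)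
qed

text \<open>\<open>tr_R\<close> intertwines the exponentials, and it sends
  \<open>X \<otimes> ketbra k k\<close> to \<open>X\<close> for every label \<open>k\<close>; this
  is where the label disappears. It serves the periodic clock, the original cut-off clock in the
  degenerate case, and the modified one.\<close>

lemma autonomous_clockwork_exp_map:
  fixes M :: "('c::finite, 'n::finite) evolution"
  assumes "bounded_linear \<L>" "bounded_linear \<L>'" "\<And>Y. tr_R (\<L> Y) = \<L>' (tr_R Y)"
    and "\<And>t. 0 \<le> t \<Longrightarrow> M t = exp_map t \<L>"
  shows "autonomous_clockwork M \<L>'"
  unfolding autonomous_clockwork_def
proof (intro allI impI ballI ext)
  fix t :: real and k and X :: "'c op"
  let ?Y = "X \<otimes> ketbra (int k) (int k) :: ('c, 'n) joint_op"
  assume "0 \<le> t" and k: "k \<in> {0..CARD('n)}"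
  then have "clockwork_channel M k t X = tr_R (exp_map t \<L> ?Y)"
    by (simp add: clockwork_channel_def from_tick_def assms(4))
  also have "\<dots> = exp_map t \<L>' (tr_R ?Y)"
    by (rule exp_map_intertwine[OF assms(1,2) bounded_linear_tr_R assms(3)])
  also have "tr_R ?Y = X"
    using k by (simp add: tr_R_tensor trace_ketbra)
  finally show "clockwork_channel M k t X = exp_map t \<L>' X" .
qed

section \<open>The correction of the generator at the last tick\<close>

abbreviation last_tick :: "('n::finite) reg op"
  where "last_tick \<equiv> ketbra (int CARD('n)) (int CARD('n))"

definition last_tick_generator ::
    "nat \<Rightarrow> (nat \<Rightarrow> ('c::finite) op) \<Rightarrow> ('c, 'n::finite) joint_op \<Rightarrow> ('c, 'n) joint_op"
  where "last_tick_generator N J Y = (\<Sum>j=1..N. dissipator (J j \<otimes> last_tick) Y)"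

text \<open>The part of \<open>lindblad\<close> that the cut-off clock fails to apply once the
  register has reached its last tick.\<close>

definition tick_generator :: "nat \<Rightarrow> (nat \<Rightarrow> ('c::finite) op) \<Rightarrow> 'c op \<Rightarrow> 'c op"
  where "tick_generator N J X = (\<Sum>j=1..N. dissipator (J j) X)"

lemma clinear_tick_generator: "clinear (tick_generator N J)"
  unfolding tick_generator_def[abs_def]
  by (intro clinear_cp_generator cp_generator_sum cp_generator_dissipator)

lemma last_tick_generator_at_last:
  "last_tick_generator N J (X \<otimes> last_tick) = tick_generator N J X \<otimes> last_tick"
  by (simp add: last_tick_generator_def tick_generator_def dissipator_tensor dagger_ketbra ketbra_mult
      tensor_sum_left)

lemma last_tick_generator_elsewhere:
  "k < CARD('n) \<Longrightarrow>
    last_tick_generator N J (X \<otimes> ketbra (int k) (int k) :: ('c::finite, 'n::finite) joint_op) = 0"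
  by (simp add: last_tick_generator_def dissipator_tensor_eq_0 dagger_ketbra ketbra_mult)

lemma tr_R_last_tick_generator:
  "tr_R (last_tick_generator N J Y) = tick_generator N J (tr_R ((mat 1 \<otimes> last_tick) ** Y))"
  by (simp add: last_tick_generator_def tick_generator_def tr_R_sum tr_R_dissipator dagger_ketbra
      ketbra_mult)

lemma tr_R_periodic_generator: "tr_R (clock_generator 1 N H L J Y) = lindblad N H L J (tr_R Y)"
  by (simp add: tr_R_clock_generator dagger_advance_mult_advance lindblad_def)
    (simp add: smul_def zero_vec_def[symmetric] tensor_mat_1)

lemma tr_R_cutoff_generator:
  "tr_R (clock_generator 0 N H L J Y) + tr_R (last_tick_generator N J Y) = lindblad N H L J (tr_R Y)"
proof -
  let ?Q = "(advance 0)\<dagger> ** advance 0 :: 'b reg op"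
  \<comment> \<open>The register weights of the cut-off jumps and of the correction are
    complementary projections, so by additivity of the dissipator the two contributions add up to
    the full jump term.\<close>
  have "?Q + last_tick = mat 1"
    by (simp add: dagger_advance_mult_advance) (simp add: smul_def vec_eq_iff)
  then have "(mat 1 \<otimes> ?Q) ** Y + (mat 1 \<otimes> last_tick) ** Y = Y"
    by (simp add: tensor_mat_1 flip: matrix_mult_simps(1) tensor_add_right)
  then have "dissipator A (tr_R ((mat 1 \<otimes> ?Q) ** Y)) + dissipator A (tr_R ((mat 1 \<otimes> last_tick) ** Y)) =
      dissipator A (tr_R Y)" for A
    by (simp flip: dissipator_add tr_R_add)
  then show ?thesis
    by (simp add: tr_R_clock_generator tr_R_last_tick_generator tick_generator_def lindblad_def
        add.assoc flip: sum.distrib)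
qed

lemma hermitian_tensor_mat_1: "hermitian H \<Longrightarrow> hermitian (H \<otimes> mat 1)"
  by (simp add: hermitian_def dagger_tensor)

theorem proposition3:
  fixes H :: "('c::finite) op" and L J :: "nat \<Rightarrow> 'c op" and N\<^sub>L :: nat
    and \<rho>0 :: "('c, 'n::finite) joint_op" and M :: "('c, 'n) evolution"
  assumes "hermitian H"
    and "classical_register M"
  shows "(periodic_clock (\<rho>0, M) \<and> (\<forall>t\<ge>0. M t = exp_map t (clock_generator 1 N\<^sub>L H L J)) \<longrightarrow>
            autonomous_clockwork M (lindblad N\<^sub>L H L J)) \<and>
         (cutoff_clock (\<rho>0, M) \<and> (\<forall>t\<ge>0. M t = exp_map t (clock_generator 0 N\<^sub>L H L J)) \<longrightarrow>
            (\<exists>\<rho>0' M'. cutoff_clock (\<rho>0', M') \<and>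
              ((\<rho>0', M') = (\<rho>0, M) \<or> clockwork_equivalent (\<rho>0, M) (\<rho>0', M')) \<and>
              autonomous_clockwork M' (lindblad N\<^sub>L H L J)))"
proof -
  let ?\<L>\<^sub>C = "lindblad N\<^sub>L H L J"
  let ?\<L> = "clock_generator 0 N\<^sub>L H L J :: ('c, 'n) joint_op \<Rightarrow> _"
  let ?K = "last_tick_generator N\<^sub>L J :: ('c, 'n) joint_op \<Rightarrow> _"
  let ?\<L>' = "\<lambda>Y. ?\<L> Y + ?K Y"
  let ?P = "last_tick :: 'n reg op"
  have gen: "cp_generator (clock_generator l N\<^sub>L H L J :: ('c, 'n) joint_op \<Rightarrow> _)" for l
    unfolding clock_generator_def by (intro cp_generator_lindblad hermitian_tensor_mat_1 assms(1))
  have gen': "cp_generator ?\<L>'"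
    unfolding last_tick_generator_def
    by (intro cp_generator_add cp_generator_sum cp_generator_dissipator gen)
  note blI = clinear_imp_bounded_linear clinear_cp_generator
  have bl_C: "bounded_linear ?\<L>\<^sub>C"
    by (intro blI cp_generator_lindblad assms(1))
  have bl: "bounded_linear ?\<L>" and bl': "bounded_linear ?\<L>'"
    by (intro blI gen gen')+
  show ?thesis
  proof (intro conjI impI; elim conjE)
    assume "\<forall>t\<ge>0. M t = exp_map t (clock_generator 1 N\<^sub>L H L J)"
    then show "autonomous_clockwork M ?\<L>\<^sub>C"
      by (intro autonomous_clockwork_exp_map[OF blI(1)[OF blI(2)[OF gen]] bl_C tr_R_periodic_generator])
        simp
  next
    assume clock: "cutoff_clock (\<rho>0, M)" and "\<forall>t\<ge>0. M t = exp_map t ?\<L>"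
    then have M: "M t = exp_map t ?\<L>" if "0 \<le> t" for t
      using that by blast
    show "\<exists>\<rho>0' M'. cutoff_clock (\<rho>0', M') \<and>
        ((\<rho>0', M') = (\<rho>0, M) \<or> clockwork_equivalent (\<rho>0, M) (\<rho>0', M')) \<and> autonomous_clockwork M' ?\<L>\<^sub>C"
    \<comment> \<open>If the jumps have no net effect on the clockwork, the given clock itself is
      the witness; otherwise the modified clock can be told apart from it.\<close>
    proof (cases "\<forall>X. tick_generator N\<^sub>L J X = 0")
      case True
      have "tr_R (?\<L> Y) = ?\<L>\<^sub>C (tr_R Y)" for Y
        using tr_R_cutoff_generator[of N\<^sub>L H L J Y] True by (simp add: tr_R_last_tick_generator)
      then have "autonomous_clockwork M ?\<L>\<^sub>C"
        by (rule autonomous_clockwork_exp_map[OF bl bl_C _ M])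
      with clock show ?thesis
        by blast
    next
      case False
      define M' where "M' t = exp_map t ?\<L>'" for t
      have auto: "autonomous_clockwork M' ?\<L>\<^sub>C"
        by (rule autonomous_clockwork_exp_map[OF bl' bl_C])
          (simp_all add: tr_R_add tr_R_cutoff_generator M'_def)
      have "trace (?\<L>' Y) = 0" for Y
        by (simp add: trace_add clock_generator_def trace_lindblad last_tick_generator_def trace_sum
            trace_dissipator)
      then have channels: "channel_family M'"
        unfolding channel_family_def M'_def by (intro allI impI channel_exp_map[OF gen'])
      have self: "self_timed M'"
        by (simp add: self_timed_def M'_def exp_map_add[OF bl'])
      have same_orders: "(\<lambda>t. norm (T (from_tick M k t \<rho>) - T (from_tick M' k t \<rho>))) \<in> o[at_right 0](\<lambda>t. t)"
        if T: "bounded_linear T" and zero: "T (?K (\<rho> \<otimes> ketbra (int k) (int k))) = 0"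
        for T :: "('c, 'n) joint_op \<Rightarrow> 'z::real_normed_vector" and \<rho> k
      proof -
        let ?Y = "\<rho> \<otimes> ketbra (int k) (int k) :: ('c, 'n) joint_op"
        have "T (?\<L> ?Y - ?\<L>' ?Y) = 0"
          using zero linear_neg[OF bounded_linear.linear[OF T]] by simp
        then have "(\<lambda>t. norm (T (exp_map t ?\<L> ?Y - exp_map t ?\<L>' ?Y))) \<in> o[at_right 0](\<lambda>t. t)"
          by (rule exp_map_diff_smallo[OF bl bl' T])
        \<comment> \<open>\<open>M\<close> is known to be an exponential only for
          \<open>t \<ge> 0\<close>, hence equality merely to the right of 0.\<close>
        moreover have "\<forall>\<^sub>F t in at_right 0. norm (T (from_tick M k t \<rho>) - T (from_tick M' k t \<rho>)) =
            norm (T (exp_map t ?\<L> ?Y - exp_map t ?\<L>' ?Y))"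
          by (rule eventually_mono[OF eventually_at_right_less])
            (simp add: from_tick_def M M'_def linear_diff[OF bounded_linear.linear[OF T]])
        ultimately show ?thesis
          by (simp add: landau_o.small.in_cong)
      qed
      have before: "(\<lambda>t. norm (from_tick M k t \<rho> - from_tick M' k t \<rho>)) \<in> o[at_right 0](\<lambda>t. t)"
        if "k < CARD('n)" for k \<rho>
        by (rule same_orders[OF bounded_linear_ident]) (rule last_tick_generator_elsewhere[OF that])
      have last: "(\<lambda>t. norm (tr_C (from_tick M CARD('n) t \<rho>) - tr_C (from_tick M' CARD('n) t \<rho>)))
          \<in> o[at_right 0](\<lambda>t. t)" for \<rho>
      proof (rule same_orders[OF bounded_linear_tr_C])
        \<comment> \<open>At the last tick the correction changes the clockwork by traceless
          dissipators and leaves the register alone, so the register marginal does not see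
          it.\<close>
        show "tr_C (?K (\<rho> \<otimes> ?P)) = 0"
          by (simp add: last_tick_generator_at_last tr_C_tensor tick_generator_def trace_sum
              trace_dissipator) (simp add: smul_def vec_eq_iff)
      qed
      have underlying: "underlying_periodic M P \<longleftrightarrow> underlying_periodic M' P" for P
      proof
        assume "underlying_periodic M P"
        then show "underlying_periodic M' P"
          by (rule underlying_periodic_if_smallo)
            (use before last in \<open>simp_all add: norm_minus_commute\<close>)
      next
        assume "underlying_periodic M' P"
        then show "underlying_periodic M P"
          by (rule underlying_periodic_if_smallo) (assumption | rule before last)+
      qed
      \<comment> \<open>A periodic family underlying \<open>M\<close> exists by
        \<open>clock\<close>, and it underlies \<open>M'\<close> as well; the initial state is
        kept.\<close>
      with clock channels self have clock': "cutoff_clock (\<rho>0, M')"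
        by (simp add: cutoff_clock_def cutoff_evolution_def)
      have "\<exists>t\<ge>0. \<exists>\<rho>. density_op \<rho> \<and>
          tr_R (from_tick M CARD('n) t \<rho>) \<noteq> tr_R (from_tick M' CARD('n) t \<rho>)"
      proof (rule ccontr)
        assume "\<not> ?thesis"
        then have same: "tr_R (exp_map t ?\<L> (\<rho> \<otimes> ?P) - exp_map t ?\<L>' (\<rho> \<otimes> ?P)) = 0"
          if "density_op \<rho>" "0 \<le> t" for \<rho> t
          using that by (auto simp: from_tick_def M M'_def tr_R_diff)
        have "tick_generator N\<^sub>L J \<rho> = 0" if \<rho>: "density_op \<rho>" for \<rho>
        proof -
          let ?f = "\<lambda>t. tr_R (exp_map t ?\<L> (\<rho> \<otimes> ?P) - exp_map t ?\<L>' (\<rho> \<otimes> ?P))"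
          \<comment> \<open>Agreement is assumed only for \<open>t \<ge> 0\<close>, so the
            derivative is taken within the half line, where it is still unique because 0 is a limit
            point.\<close>
          have "(?f has_vector_derivative tr_R (?\<L> (\<rho> \<otimes> ?P) - ?\<L>' (\<rho> \<otimes> ?P))) (at 0 within {0..})"
            by (rule has_vector_derivative_at_within
                [OF exp_map_diff_has_vector_derivative[OF bl bl' bounded_linear_tr_R]])
          moreover have "(?f has_vector_derivative 0) (at 0 within {0..})"
            by (rule has_vector_derivative_transform[where f = "\<lambda>_. 0"])
              (simp_all add: same[OF \<rho>])
          moreover have "at 0 within {0::real..} \<noteq> bot"
            by (simp add: at_within_Ici_at_right)
          ultimately have "tr_R (?\<L> (\<rho> \<otimes> ?P) - ?\<L>' (\<rho> \<otimes> ?P)) = 0"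
            using vector_derivative_unique_within by blast
          \<comment> \<open>The generators differ by \<open>?K\<close>, whose partial trace at the
            last tick is \<open>tick_generator\<close> applied to \<open>\<rho>\<close>.\<close>
          then have "tr_R (?K (\<rho> \<otimes> ?P)) = 0"
            by (simp only: tr_R_add tr_R_diff) simp
          then show ?thesis
            by (simp add: last_tick_generator_at_last tr_R_tensor trace_ketbra)
        qed
        \<comment> \<open>Vanishing on all density operators forces \<open>tick_generator\<close> to
          vanish identically, which this case excludes.\<close>
        with False show False
          using clinear_zero_if_zero_on_density_op[OF clinear_tick_generator] by blast
      qed
      with clock clock' underlying have "clockwork_equivalent (\<rho>0, M) (\<rho>0, M')"
        by (simp add: clockwork_equivalent_def)
      with clock' auto show ?thesis
        by blast
    qed
  qed
qed

end
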